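(* Let $X$ be a finite-dimensional real Hilbert space, $H:X\to(-\infty,+\infty]$ a proper closed convex function, and $F:X\to\mathbb{R}$ a differentiable function whose gradient $f=\nabla F$ is Lipschitz continuous with constant $L>0$. Let $E=H+F$ be level-bounded. Let $M$ be a symmetric positive semi-definite linear operator on $X$, let $\alpha>\frac{4}{77}$, $0<\delta t<\frac{8}{77L}$, and let $\{\beta_n\}_n\subset[0,1)$ with $\sup_n\beta_n<1$. Let $\{x^n\}_n$ be the sequence generated by the algorithm described in the context, and let $$A(x,y,z)=E(x)+\left(\frac{9}{11\delta t}+\frac{3L}{2}\right)\|x-y\|^2+\left(\frac{2}{11\delta t}+\frac{L}{2}\right)\|y-z\|^2+\frac12\|x-y\|_M^2,\qquad (x,y,z)\in X^3 .$$ Assume that $A$ is a KL function (satisfies the Kurdyka-\L ojasiewicz property) on $X^3$. Then: (i) $\lim_{n\to\infty}\operatorname{dist}\big(\mathbf{0},\partial A(x^{n+1},x^n,x^{n-1})\big)=0$. (ii) The sequence $\{A(x^{n+1},x^n,x^{n-1})\}_n$ is non-increasing and has a limit, i.e. there exists a constant $\zeta$ such that $\lim_{n\to\infty}A(x^{n+1},x^n,x^{n-1})=\zeta$; and $\{x^n\}_n$ is bounded. (iii) $\{x^n\}_n$ converges to a critical point of $E$, and $\sum_{n=0}^{\infty}\|x^{n+1}-x^n\|<\infty$.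
   Context: Notation: $\|x\|_M^2:=\langle Mx,x\rangle$. $\partial$ denotes the (limiting) subdifferential; for $E=H+F$ one has $\partial E(x)=\partial H(x)+f(x)$ with $\partial H$ the convex subdifferential, and $\partial A$ is the sum of $\partial H$ (in the first component) and the gradient of the remaining smooth terms. A critical point of a function $h$ is a point $\bar x$ with $0\in\partial h(\bar x)$. $\operatorname{dist}(\mathbf 0,S)=\inf_{s\in S}\|s\|$. Level-bounded: for every $a\in\mathbb{R}$ the set $\{x:E(x)\le a\}$ is bounded (possibly empty). KL property: a proper closed function $h$ on a Euclidean space satisfies the KL property (is a KL function) if for every critical point $\bar x$ of $h$ there exist $\nu\in(0,+\infty]$, a neighborhood $\mathcal{O}$ of $\bar x$, and a continuous concave function $\psi:[0,\nu)\to[0,+\infty)$ with $\psi(0)=0$, such that $\psi$ is continuously differentiable on $(0,\nu)$ with $\psi'>0$ there, and for every $x\in\mathcal{O}$ with $h(\bar x)<h(x)<h(\bar x)+\nu$ one has $\psi'(h(x)-h(\bar x))\cdot\operatorname{dist}(\mathbf{0},\partial h(x))\ge 1$. Algorithm: choose $x^0\in X$ and set $x^{-1}=x^1=x^0$. For $n=1,2,\dots$ set $y^n=x^n+\beta_n(x^n-x^{n-1})$ and $$x^{n+1}=\arg\min_{x\in X}\Big\{H^n(x)-\langle\nabla F^n(x^n),x\rangle+\tfrac12\|x-y^n\|_M^2\Big\},$$ where $$H^n(x)=H(x)+\tfrac{1}{\delta t}\|x-x^n\|^2,$$ $$F^n(x)=\tfrac{\alpha}{\delta t}\|x-x^n\|^2+\tfrac{14}{11\delta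 t}\langle x-x^n,x^n-x^{n-1}\rangle-\tfrac{4}{11\delta t}\langle x-x^{n-1},x^{n-1}-x^{n-2}\rangle-F(x)-2\langle f(x^n)-f(x^{n-1}),x-x^{n-1}\rangle+\langle f(x^{n-1})-f(x^{n-2}),x-x^{n-2}\rangle.$$ Equivalently, $x^{n+1}$ is determined by $$0\in\tfrac{12}{11\delta t}\big[\tfrac{11}{6}x^{n+1}-3x^n+\tfrac32x^{n-1}-\tfrac13x^{n-2}\big]+M(x^{n+1}-y^n)+\partial H(x^{n+1})+3f(x^n)-3f(x^{n-1})+f(x^{n-2}).$$ The iteration is run indefinitely (no stopping criterion). *)

theory Defs
  imports "HOL-Analysis.Analysis"
begin

definition epi :: "('a \<Rightarrow> ereal) \<Rightarrow> ('a \<times> real) set" where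
  "epi h = {(x, r). h x \<le> ereal r}"

definition proper_fun :: "('a \<Rightarrow> ereal) \<Rightarrow> bool" where
  "proper_fun h \<longleftrightarrow> (\<forall>x. h x \<noteq> -\<infinity>) \<and> (\<exists>x. h x \<noteq> \<infinity>)"

definition closed_fun :: "('a::topological_space \<Rightarrow> ereal) \<Rightarrow> bool" where
  "closed_fun h \<longleftrightarrow> closed (epi h)"

definition convex_fun :: "('a::real_vector \<Rightarrow> ereal) \<Rightarrow> bool" where
  "convex_fun h \<longleftrightarrow> convex (epi h)"

definition level_bounded :: "('a::metric_space \<Rightarrow> ereal) \<Rightarrow> bool" where
  "level_bounded h \<longleftrightarrow> (\<forall>a::real. bounded {x. h x \<le> ereal a})"

(* The limiting (Mordukhovich) subdifferential, obtained from the Frechet subdifferential by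
   h-attentive limits.  Both are empty outside the effective domain. *)

definition frechet_subdiff :: "('a::real_inner \<Rightarrow> ereal) \<Rightarrow> 'a \<Rightarrow> 'a set" where
  "frechet_subdiff h x =
     {v. \<bar>h x\<bar> \<noteq> \<infinity> \<and>
         Liminf (at x) (\<lambda>y. (h y - h x - ereal (v \<bullet> (y - x))) / ereal (norm (y - x))) \<ge> 0}"

definition subdiff :: "('a::real_inner \<Rightarrow> ereal) \<Rightarrow> 'a \<Rightarrow> 'a set" where
  "subdiff h x =
     {v. \<bar>h x\<bar> \<noteq> \<infinity> \<and>
         (\<exists>(u :: nat \<Rightarrow> 'a) w. u \<longlonglongrightarrow> x \<and> (\<lambda>k. h (u k)) \<longlonglongrightarrow> h x \<and>
            (\<forall>k. w k \<in> frechet_subdiff h (u k)) \<and> w \<longlonglongrightarrow> v)}"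

definition critical_point :: "('a::real_inner \<Rightarrow> ereal) \<Rightarrow> 'a \<Rightarrow> bool" where
  "critical_point h x \<longleftrightarrow> 0 \<in> subdiff h x"

(* Extended-real-valued, so that the distance to the empty set is \<infinity>;
   infdist and setdist would give 0 there. *)
definition dist0 :: "'a::real_normed_vector set \<Rightarrow> ereal" where
  "dist0 S = (INF s\<in>S. ereal (norm s))"

definition KL_property :: "('a::real_inner \<Rightarrow> ereal) \<Rightarrow> bool" where
  "KL_property h \<longleftrightarrow>
     (\<forall>xb. critical_point h xb \<longrightarrow>
       (\<exists>(\<nu>::ereal) U (\<psi>::real \<Rightarrow> real) (\<psi>'::real \<Rightarrow> real).
          \<nu> > 0 \<and> open U \<and> xb \<in> U \<and>
          continuous_on {t. 0 \<le> t \<and> ereal t < \<nu>} \<psi> \<and>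
          concave_on {t. 0 \<le> t \<and> ereal t < \<nu>} \<psi> \<and>
          (\<forall>t. 0 \<le> t \<and> ereal t < \<nu> \<longrightarrow> \<psi> t \<ge> 0) \<and>
          \<psi> 0 = 0 \<and>
          (\<forall>t. 0 < t \<and> ereal t < \<nu> \<longrightarrow> (\<psi> has_real_derivative \<psi>' t) (at t) \<and> \<psi>' t > 0) \<and>
          continuous_on {t. 0 < t \<and> ereal t < \<nu>} \<psi>' \<and>
          (\<forall>x\<in>U. h xb < h x \<and> h x < h xb + \<nu> \<longrightarrow>
             ereal (\<psi>' (real_of_ereal (h x - h xb))) * dist0 (subdiff h x) \<ge> 1)))"

definition grad :: "('a::real_inner \<Rightarrow> real) \<Rightarrow> 'a \<Rightarrow> 'a" where
  "grad g x = (THE D. GDERIV g x :> D)"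

lemma grad_eqI:
  assumes "GDERIV g x :> D"
  shows "grad g x = D"
  unfolding grad_def
proof (rule the_equality)
  fix D' assume "GDERIV g x :> D'"
  with assms have "(\<lambda>h. h \<bullet> D') = (\<lambda>h. h \<bullet> D)"
    unfolding gderiv_def by (rule has_derivative_unique[rotated])
  then show "D' = D"
    by (metis vector_eq_ldot)
qed (rule assms)

definition sq_seminorm :: "('a::real_inner \<Rightarrow> 'a) \<Rightarrow> 'a \<Rightarrow> real" where
  "sq_seminorm M x = M x \<bullet> x"

definition psd_operator :: "('a::real_inner \<Rightarrow> 'a) \<Rightarrow> bool" where
  "psd_operator M \<longleftrightarrow> linear M \<and> (\<forall>x y. M x \<bullet> y = x \<bullet> M y) \<and> (\<forall>x. M x \<bullet> x \<ge> 0)"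

definition energy :: "('a \<Rightarrow> ereal) \<Rightarrow> ('a \<Rightarrow> real) \<Rightarrow> 'a \<Rightarrow> ereal" where
  "energy H F x = H x + ereal (F x)"

definition aux_energy ::
  "('a::real_inner \<Rightarrow> ereal) \<Rightarrow> ('a \<Rightarrow> real) \<Rightarrow> real \<Rightarrow> real \<Rightarrow> ('a \<Rightarrow> 'a) \<Rightarrow> 'a \<times> 'a \<times> 'a \<Rightarrow> ereal" where
  "aux_energy H F L \<delta>t M = (\<lambda>(x, y, z). energy H F x +
     ereal ((9 / (11 * \<delta>t) + 3 * L / 2) * (norm (x - y))\<^sup>2 +
            (2 / (11 * \<delta>t) + L / 2) * (norm (y - z))\<^sup>2 +
            1 / 2 * sq_seminorm M (x - y)))"

(* In the next three definitions u, v, w stand for the iterates x^n, x^(n-1), x^(n-2). *)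

definition H_step :: "('a::real_inner \<Rightarrow> ereal) \<Rightarrow> real \<Rightarrow> 'a \<Rightarrow> 'a \<Rightarrow> ereal" where
  "H_step H \<delta>t u x = H x + ereal (1 / \<delta>t * (norm (x - u))\<^sup>2)"

definition F_step ::
  "('a::real_inner \<Rightarrow> real) \<Rightarrow> ('a \<Rightarrow> 'a) \<Rightarrow> real \<Rightarrow> real \<Rightarrow> 'a \<Rightarrow> 'a \<Rightarrow> 'a \<Rightarrow> 'a \<Rightarrow> real" where
  "F_step F f \<alpha> \<delta>t u v w x =
     \<alpha> / \<delta>t * (norm (x - u))\<^sup>2
     + 14 / (11 * \<delta>t) * ((x - u) \<bullet> (u - v))
     - 4 / (11 * \<delta>t) * ((x - v) \<bullet> (v - w))
     - F x
     - 2 * ((f u - f v) \<bullet> (x - v))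
     + (f v - f w) \<bullet> (x - w)"

definition step_objective ::
  "('a::real_inner \<Rightarrow> ereal) \<Rightarrow> ('a \<Rightarrow> real) \<Rightarrow> ('a \<Rightarrow> 'a) \<Rightarrow> ('a \<Rightarrow> 'a) \<Rightarrow> real \<Rightarrow> real \<Rightarrow> real \<Rightarrow>
   'a \<Rightarrow> 'a \<Rightarrow> 'a \<Rightarrow> 'a \<Rightarrow> ereal" where
  "step_objective H F f M \<alpha> \<delta>t b u v w x =
     H_step H \<delta>t u x
     - ereal (grad (F_step F f \<alpha> \<delta>t u v w) u \<bullet> x)
     + ereal (1 / 2 * sq_seminorm M (x - (u + b *\<^sub>R (u - v))))"

(* The sequence is indexed by int because the iteration starts from x^(-1) = x^0 = x^1; only
   the indices \<ge> -1 matter.  The objective is strongly convex when H is proper, closed and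
   convex and \<delta>t > 0, so being a minimiser determines the next iterate. *)
definition algorithm_sequence ::
  "('a::real_inner \<Rightarrow> ereal) \<Rightarrow> ('a \<Rightarrow> real) \<Rightarrow> ('a \<Rightarrow> 'a) \<Rightarrow> ('a \<Rightarrow> 'a) \<Rightarrow> real \<Rightarrow> real \<Rightarrow>
   (nat \<Rightarrow> real) \<Rightarrow> (int \<Rightarrow> 'a) \<Rightarrow> bool" where
  "algorithm_sequence H F f M \<alpha> \<delta>t \<beta> x \<longleftrightarrow>
     x (-1) = x 0 \<and> x 1 = x 0 \<and>
     (\<forall>n::nat\<ge>1.
        is_arg_min
          (step_objective H F f M \<alpha> \<delta>t (\<beta> n) (x (int n)) (x (int n - 1)) (x (int n - 2)))
          (\<lambda>_. True) (x (int n + 1)))"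

end

theory Submission
  imports Defs
begin

text \<open>
The function \<open>A\<close> is a Lyapunov function for the iteration, and the proof is the
descent scheme of Kurdyka-Lojasiewicz type carried out for a three-step recursion.

Let \<open>w, v, u, x\<close> be consecutive iterates.  Minimality of \<open>x\<close> in the
subproblem says that a certain vector, explicit in the iterates, is a convex subgradient of
\<open>H\<close> at \<open>x\<close>.  Two facts follow.  Testing the subgradient inequality at
\<open>u\<close>, bounding \<open>F\<close> by its quadratic upper model, and splitting every cross term by
\<open>2pq \<le> p\<^sup>2 + q\<^sup>2\<close>, the multiples of \<open>\<parallel>u - v\<parallel>\<^sup>2\<close> and \<open>\<parallel>v - w\<parallel>\<^sup>2\<close> are
exactly those absorbed by the quadratic terms of \<open>A\<close>, and what remains is a decrease of
\<open>A\<close> by at least \<open>(4 / (11 \<delta>t) - 7L / 2) \<parallel>x - u\<parallel>\<^sup>2\<close>; the bound on the step size is the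
positivity of this factor (\<open>sufficient_decrease\<close>).  On the other hand, adding the gradients of
the smooth terms to the same vector gives an element of the subdifferential of \<open>A\<close> whose norm
is at most a constant times the sum of the last three step lengths (\<open>relative_error\<close>).

Descent keeps the iterates in a level set of \<open>E\<close>, hence bounded, and the values of \<open>A\<close>
converge to some \<open>\<zeta>\<close> while the step lengths, and with them the subdifferential elements just found, tend to zero.  At
a cluster point the epigraph of \<open>H\<close> being closed bounds the value of \<open>H\<close> from above and
the subgradient inequalities bound it from below, so the values of \<open>A\<close> converge to its value
there.  The cluster point is therefore critical for both \<open>A\<close> and \<open>E\<close>, directly from the
definition of the limiting subdifferential (\<open>cluster_point_critical\<close>).

The KL inequality near a single cluster point finishes the argument.  A desingularising function
\<open>\<psi>\<close> turns the decrease of \<open>A\<close> into a bound of each step length by a decrease of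
\<open>\<psi>\<close> plus one sixth of the sum of the three preceding step lengths.  A potential that adds
weighted step lengths to a multiple of \<open>\<psi>\<close> then drops by at least the length of every step
(\<open>KL_finite_length\<close>).  Once the iterate is close to the cluster point and the potential is
small, the remaining steps cannot leave the neighbourhood, and their lengths sum up.
\<close>

section \<open>Subgradients and smooth functions\<close>

definition is_subgradient :: "('a::real_inner \<Rightarrow> ereal) \<Rightarrow> 'a \<Rightarrow> 'a \<Rightarrow> bool" where
  "is_subgradient h v x \<longleftrightarrow> \<bar>h x\<bar> \<noteq> \<infinity> \<and> (\<forall>w. h x + ereal (v \<bullet> (w - x)) \<le> h w)"

lemma is_subgradientD: "is_subgradient h v x \<Longrightarrow> h x + ereal (v \<bullet> (w - x)) \<le> h w"
  by (simp add: is_subgradient_def)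

text \<open>
A quadratic lower bound for the error, valid globally, dominates the difference quotient by
\<open>- K \<parallel>y - x\<parallel>\<close>.  All Frechet subgradients below arise this way: convex terms contribute no
error, and the function \<open>F\<close> contributes at most \<open>L / 2\<close>.
\<close>
lemma frechet_subdiffI_quadratic:
  fixes x :: "'a::euclidean_space"
  assumes fin: "\<bar>h x\<bar> \<noteq> \<infinity>"
    and low: "\<And>y. h x + ereal (v \<bullet> (y - x) - K * (norm (y - x))\<^sup>2) \<le> h y"
  shows "v \<in> frechet_subdiff h x"
proof -
  obtain r where r: "h x = ereal r" using fin by auto
  have quot: "ereal (- K * norm (y - x)) \<le> (h y - h x - ereal (v \<bullet> (y - x))) / ereal (norm (y - x))"
    if "y \<noteq> x" for y
  proof -
    have pos: "norm (y - x) > 0" using that by simp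
    show ?thesis
    proof (cases "h y")
      case (real s)
      have "- K * norm (y - x) * norm (y - x) \<le> s - r - v \<bullet> (y - x)"
        using low[of y] real r by (simp add: power2_eq_square algebra_simps)
      then show ?thesis using pos real r by (simp add: pos_le_divide_eq)
    next
      case PInf
      then show ?thesis using pos r by simp
    next
      case MInf
      then show ?thesis using low[of y] r by simp
    qed
  qed
  have "((\<lambda>y. ereal (- K * norm (y - x))) \<longlongrightarrow> ereal (- K * norm (x - x))) (at x)"
    by (intro tendsto_intros)
  then have "Liminf (at x) (\<lambda>y. ereal (- K * norm (y - x))) = 0"
    by (simp add: lim_imp_Liminf zero_ereal_def)
  moreover have "Liminf (at x) (\<lambda>y. ereal (- K * norm (y - x)))
      \<le> Liminf (at x) (\<lambda>y. (h y - h x - ereal (v \<bullet> (y - x))) / ereal (norm (y - x)))"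
    using quot by (intro Liminf_mono) (auto simp: eventually_at_filter)
  ultimately show ?thesis using fin by (simp add: frechet_subdiff_def)
qed

lemma frechet_subset_subdiff: "frechet_subdiff h x \<subseteq> subdiff h x"
proof
  fix v assume v: "v \<in> frechet_subdiff h x"
  then have "\<bar>h x\<bar> \<noteq> \<infinity>" by (simp add: frechet_subdiff_def)
  with v show "v \<in> subdiff h x"
    unfolding subdiff_def mem_Collect_eq
    by (intro conjI exI[of _ "\<lambda>_. x"] exI[of _ "\<lambda>_. v"]) auto
qed

lemma dist0_le: "v \<in> S \<Longrightarrow> dist0 S \<le> ereal (norm v)"
  unfolding dist0_def by (rule INF_lower)

lemma dist0_nonneg: "0 \<le> dist0 S"
  unfolding dist0_def by (rule INF_greatest) simp

text \<open>
Along the segment from \<open>x\<close> to \<open>y\<close>, subtracting the quadratic model from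
\<open>F\<close> leaves a function whose derivative is nonpositive because \<open>f\<close> is Lipschitz.
\<close>
lemma descent_lemma_upper:
  fixes F :: "'a::euclidean_space \<Rightarrow> real"
  assumes grad: "\<And>u. GDERIV F u :> f u" and lip: "L-lipschitz_on UNIV f"
  shows "F y \<le> F x + f x \<bullet> (y - x) + L / 2 * (norm (y - x))\<^sup>2"
proof -
  define d where "d = y - x"
  define \<phi> where "\<phi> t = F (x + t *\<^sub>R d) - t * (f x \<bullet> d) - L / 2 * t\<^sup>2 * (norm d)\<^sup>2" for t :: real
  have der: "(\<phi> has_real_derivative (d \<bullet> f (x + t *\<^sub>R d) - f x \<bullet> d - L * t * (norm d)\<^sup>2)) (at t)" for t
  proof -
    have "((\<lambda>t. F (x + t *\<^sub>R d)) has_derivative (\<lambda>h. (h *\<^sub>R d) \<bullet> f (x + t *\<^sub>R d))) (at t)"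
      by (rule has_derivative_compose[where g=F, OF _ grad[unfolded gderiv_def]])
        (auto intro!: derivative_eq_intros)
    then have "((\<lambda>t. F (x + t *\<^sub>R d)) has_real_derivative d \<bullet> f (x + t *\<^sub>R d)) (at t)"
      by (simp add: has_field_derivative_def mult.commute[of _ "d \<bullet> _"] mult_commute_abs)
    then show ?thesis unfolding \<phi>_def by (auto intro!: derivative_eq_intros)
  qed
  have "\<phi> 1 \<le> \<phi> 0"
  proof (rule DERIV_nonpos_imp_nonincreasing[of 0 1 \<phi>])
    fix t :: real assume t: "0 \<le> t" "t \<le> 1"
    have "d \<bullet> f (x + t *\<^sub>R d) - f x \<bullet> d = (f (x + t *\<^sub>R d) - f x) \<bullet> d"
      by (simp add: inner_commute inner_diff_right)
    also have "\<dots> \<le> norm (f (x + t *\<^sub>R d) - f x) * norm d" by (rule norm_cauchy_schwarz)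
    also have "\<dots> \<le> (L * norm (t *\<^sub>R d)) * norm d"
      using lipschitz_onD[OF lip, of "x + t *\<^sub>R d" x]
      by (intro mult_right_mono) (auto simp: dist_norm)
    also have "\<dots> = L * t * (norm d)\<^sup>2" using t by (simp add: power2_eq_square)
    finally show "\<exists>y. (\<phi> has_real_derivative y) (at t) \<and> y \<le> 0" using der[of t] by auto
  qed simp
  then show ?thesis by (simp add: \<phi>_def d_def)
qed

lemma descent_lemma_lower:
  fixes F :: "'a::euclidean_space \<Rightarrow> real"
  assumes grad: "\<And>u. GDERIV F u :> f u" and lip: "L-lipschitz_on UNIV f"
  shows "F x + f x \<bullet> (y - x) - L / 2 * (norm (y - x))\<^sup>2 \<le> F y"
proof -
  have "GDERIV (\<lambda>u. - F u) u :> - f u" for u by (intro GDERIV_minus grad)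
  moreover have "L-lipschitz_on UNIV (\<lambda>u. - f u)" using lip by (simp add: lipschitz_on_minus)
  ultimately show ?thesis using descent_lemma_upper[of "\<lambda>u. - F u" "\<lambda>u. - f u" L y x] by simp
qed

text \<open>
Fermat's rule for a convex plus a differentiable function.  Replacing \<open>h\<close> by its chord towards
\<open>w\<close> produces a real function of one variable that is minimal at the end point 0, so its
derivative there is nonnegative, and this is the subgradient inequality at \<open>w\<close>.
\<close>
lemma subgradient_of_minimiser:
  fixes h :: "'a::euclidean_space \<Rightarrow> ereal"
  assumes conv: "convex_fun h" and notm: "\<And>w. h w \<noteq> -\<infinity>" and fin: "\<bar>h x\<bar> \<noteq> \<infinity>"
    and min: "\<And>w. h x + ereal (q x) \<le> h w + ereal (q w)"
    and der: "GDERIV q x :> g"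
  shows "is_subgradient h (- g) x"
  unfolding is_subgradient_def
proof (intro conjI allI fin)
  fix w
  obtain r where r: "h x = ereal r" using fin by auto
  show "h x + ereal (- g \<bullet> (w - x)) \<le> h w"
  proof (cases "h w")
    case (real s)
    define d where "d = w - x"
    define \<phi> where "\<phi> t = q (x + t *\<^sub>R d) + t * (s - r)" for t :: real
    have ge: "\<phi> 0 \<le> \<phi> t" if t: "0 < t" "t \<le> 1" for t
    proof -
      have "(1 - t) *\<^sub>R (x, r) + t *\<^sub>R (w, s) \<in> epi h"
        using conv t real r unfolding convex_fun_def
        by (intro convexD) (auto simp: epi_def)
      moreover have "(1 - t) *\<^sub>R (x, r) + t *\<^sub>R (w, s) = (x + t *\<^sub>R d, r + t * (s - r))"
        by (simp add: d_def algebra_simps)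
      ultimately have "h (x + t *\<^sub>R d) \<le> ereal (r + t * (s - r))" by (simp add: epi_def)
      then have "ereal r + ereal (q x) \<le> ereal (r + t * (s - r)) + ereal (q (x + t *\<^sub>R d))"
        using min[of "x + t *\<^sub>R d"] r by (metis add_right_mono order_trans)
      then show ?thesis by (simp add: \<phi>_def)
    qed
    have "((\<lambda>t. q (x + t *\<^sub>R d)) has_derivative (\<lambda>h. (h *\<^sub>R d) \<bullet> g)) (at 0)"
      by (rule has_derivative_compose[where g=q])
        (use der in \<open>auto intro!: derivative_eq_intros simp: gderiv_def\<close>)
    then have "((\<lambda>t. q (x + t *\<^sub>R d)) has_real_derivative d \<bullet> g) (at 0)"
      by (simp add: has_field_derivative_def mult_commute_abs)
    then have "(\<phi> has_real_derivative d \<bullet> g + (s - r)) (at 0)"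
      unfolding \<phi>_def by (auto intro!: derivative_eq_intros)
    then have "0 \<le> d \<bullet> g + (s - r)"
    proof (rule contrapos_pp)
      assume "\<not> 0 \<le> d \<bullet> g + (s - r)"
      then have neg: "d \<bullet> g + (s - r) < 0" by simp
      show "\<not> (\<phi> has_real_derivative d \<bullet> g + (s - r)) (at 0)"
      proof
        assume "(\<phi> has_real_derivative d \<bullet> g + (s - r)) (at 0)"
        from DERIV_neg_dec_right[OF this neg] obtain e
          where e: "e > 0" "\<And>t. 0 < t \<Longrightarrow> t < e \<Longrightarrow> \<phi> t < \<phi> 0" by auto
        define t where "t = min 1 (e / 2)"
        have "0 < t" "t \<le> 1" "t < e" using e(1) by (auto simp: t_def)
        with e(2)[of t] ge[of t] show False by simp
      qed
    qed
    then show ?thesis using real r by (simp add: d_def inner_commute)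
  qed (use notm r in auto)
qed

text \<open>
Closedness of the epigraph alone gives only lower semicontinuity.  Subgradients that converge
supply the opposite inequality, and in particular the limit point lies in the domain of
\<open>h\<close>.
\<close>
lemma subgradient_limit_value:
  fixes h :: "'a::euclidean_space \<Rightarrow> ereal"
  assumes closed: "closed_fun h" and notm: "\<And>w. h w \<noteq> -\<infinity>"
    and sub: "\<And>k. is_subgradient h (v k) (u k)"
    and val: "\<And>k. h (u k) = ereal (r k)"
    and u: "u \<longlonglongrightarrow> ub" and v: "v \<longlonglongrightarrow> vb" and r: "r \<longlonglongrightarrow> rb"
  shows "h ub = ereal rb"
proof -
  have "(\<lambda>k. (u k, r k)) \<longlonglongrightarrow> (ub, rb)" by (intro tendsto_Pair u r)
  moreover have "(u k, r k) \<in> epi h" for k by (simp add: epi_def val)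
  ultimately have "(ub, rb) \<in> epi h"
    using closed closed_sequentially[of "epi h" "\<lambda>k. (u k, r k)" "(ub, rb)"]
    unfolding closed_fun_def by blast
  then have le: "h ub \<le> ereal rb" by (simp add: epi_def)
  with notm[of ub] obtain s where s: "h ub = ereal s" by (cases "h ub") auto
  have "(\<lambda>k. r k + v k \<bullet> (ub - u k)) \<longlonglongrightarrow> rb + vb \<bullet> (ub - ub)"
    by (intro tendsto_intros u v r)
  then have "(\<lambda>k. r k + v k \<bullet> (ub - u k)) \<longlonglongrightarrow> rb" by simp
  moreover have "r k + v k \<bullet> (ub - u k) \<le> s" for k
  proof -
    have "h (u k) + ereal (v k \<bullet> (ub - u k)) \<le> h ub"
      using sub[of k] unfolding is_subgradient_def by blast
    then show ?thesis using s val[of k] by simp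
  qed
  ultimately have "rb \<le> s" by (intro LIMSEQ_le_const2) auto
  with le s show ?thesis by simp
qed

lemma psd_operator_nonneg: "psd_operator M \<Longrightarrow> 0 \<le> M v \<bullet> v"
  unfolding psd_operator_def by blast

text \<open>
The extrapolation term.  Young's inequality for the seminorm of \<open>M\<close> leaves half of
\<open>\<parallel>d\<parallel>\<^sub>M\<^sup>2\<close> available and costs half of \<open>\<parallel>e\<parallel>\<^sub>M\<^sup>2\<close>, which explains the factor one half
in front of the seminorm in the definition of \<open>A\<close>.
\<close>
lemma sq_seminorm_scale_gap:
  assumes "psd_operator M" "0 \<le> b" "b \<le> 1"
  shows "b * (M e \<bullet> d) \<le> 1 / 2 * sq_seminorm M d + 1 / 2 * sq_seminorm M e"
proof -
  interpret linear M using assms by (simp add: psd_operator_def)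
  have sym: "M d \<bullet> e = M e \<bullet> d" using assms by (metis psd_operator_def inner_commute)
  have psd: "0 \<le> M v \<bullet> v" for v using assms(1) by (rule psd_operator_nonneg)
  have "0 \<le> M (d - e) \<bullet> (d - e)" by (rule psd)
  then have *: "2 * (M e \<bullet> d) \<le> M d \<bullet> d + M e \<bullet> e"
    using sym by (simp add: diff inner_diff_left inner_diff_right)
  have "2 * (b * (M e \<bullet> d)) \<le> b * (M d \<bullet> d + M e \<bullet> e)"
    using mult_left_mono[OF * assms(2)] by simp
  also have "\<dots> \<le> 1 * (M d \<bullet> d + M e \<bullet> e)"
    using assms(3) psd by (intro mult_right_mono) (auto intro: add_nonneg_nonneg)
  finally show ?thesis by (simp add: sq_seminorm_def)
qed

lemma sq_seminorm_tangent:
  assumes "psd_operator M"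
  shows "sq_seminorm M d + 2 * (M d \<bullet> (e - d)) \<le> sq_seminorm M e"
proof -
  interpret linear M using assms by (simp add: psd_operator_def)
  have sym: "M e \<bullet> d = M d \<bullet> e" using assms by (metis psd_operator_def inner_commute)
  have "0 \<le> M (e - d) \<bullet> (e - d)" using assms by (rule psd_operator_nonneg)
  then show ?thesis
    using sym by (simp add: sq_seminorm_def diff inner_diff_left inner_diff_right)
qed

lemma norm_sq_tangent: "(norm d)\<^sup>2 + 2 * (d \<bullet> (e - d)) \<le> (norm e)\<^sup>2" for d e :: "'a::real_inner"
proof -
  have "0 \<le> (e - d) \<bullet> (e - d)" by simp
  then show ?thesis
    by (simp add: power2_norm_eq_inner inner_diff_left inner_diff_right inner_commute)
qed

lemma inner_le_half_squares: "p \<bullet> q \<le> ((norm p)\<^sup>2 + (norm q)\<^sup>2) / 2" for p q :: "'a::real_inner"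
proof -
  have "0 \<le> (p - q) \<bullet> (p - q)" by simp
  then show ?thesis
    by (simp add: power2_norm_eq_inner inner_diff_left inner_diff_right inner_commute)
qed

lemma norm_scaleR_le: "norm (k *\<^sub>R p) \<le> k * S" if "0 \<le> k" "norm p \<le> S"
  using that by (simp add: mult_left_mono)

section \<open>One step of the scheme\<close>

locale bdf_scheme =
  fixes H :: "'a::euclidean_space \<Rightarrow> ereal" and F :: "'a \<Rightarrow> real" and f M :: "'a \<Rightarrow> 'a"
    and L \<alpha> \<delta>t :: real
  assumes proper: "proper_fun H" and closed: "closed_fun H" and convex: "convex_fun H"
    and grad: "\<And>u. GDERIV F u :> f u"
    and L_pos: "0 < L" and lip: "L-lipschitz_on UNIV f"
    and level: "level_bounded (energy H F)"
    and psd: "psd_operator M"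
    and dt_pos: "0 < \<delta>t" and dt_small: "\<delta>t < 8 / (77 * L)"
begin

abbreviation "E \<equiv> energy H F"
abbreviation "A \<equiv> aux_energy H F L \<delta>t M"
abbreviation "a \<equiv> 9 / (11 * \<delta>t) + 3 * L / 2"
abbreviation "b \<equiv> 2 / (11 * \<delta>t) + L / 2"
abbreviation "decay \<equiv> 4 / (11 * \<delta>t) - 7 * L / 2"

definition is_step :: "real \<Rightarrow> 'a \<Rightarrow> 'a \<Rightarrow> 'a \<Rightarrow> 'a \<Rightarrow> bool" where
  "is_step \<theta> u v w x \<longleftrightarrow> is_arg_min (step_objective H F f M \<alpha> \<delta>t \<theta> u v w) (\<lambda>_. True) x"

text \<open>
The gradient of \<open>F_step\<close> at \<open>u\<close>, where the term
\<open>\<alpha> / \<delta>t \<parallel>x - u\<parallel>\<^sup>2\<close> is stationary.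
\<close>
definition explicit_gradient :: "'a \<Rightarrow> 'a \<Rightarrow> 'a \<Rightarrow> 'a" where
  "explicit_gradient u v w =
     (14 / (11 * \<delta>t)) *\<^sub>R (u - v) - (4 / (11 * \<delta>t)) *\<^sub>R (v - w) - f u - 2 *\<^sub>R (f u - f v) + (f v - f w)"

text \<open>
The negative gradient at \<open>x\<close> of the smooth part of the subproblem.
\<close>
definition step_subgradient :: "real \<Rightarrow> 'a \<Rightarrow> 'a \<Rightarrow> 'a \<Rightarrow> 'a \<Rightarrow> 'a" where
  "step_subgradient \<theta> u v w x =
     explicit_gradient u v w - (2 / \<delta>t) *\<^sub>R (x - u) - M (x - (u + \<theta> *\<^sub>R (u - v)))"

lemma decay_pos: "0 < decay"
proof -
  have "\<delta>t * (77 * L) < 8" using dt_small L_pos by (simp add: field_simps)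
  then show ?thesis using dt_pos by (simp add: field_simps)
qed

lemma H_not_MInf: "H w \<noteq> -\<infinity>"
  using proper by (simp add: proper_fun_def)

lemma linear_M: "linear M" using psd by (simp add: psd_operator_def)

lemma M_sym: "M p \<bullet> q = M q \<bullet> p" using psd by (metis psd_operator_def inner_commute)

lemma M_bound: "norm (M v) \<le> onorm M * norm v"
  using linear_M by (intro onorm) (simp add: linear_conv_bounded_linear)

lemma onorm_M_nonneg: "0 \<le> onorm M"
  using linear_M by (intro onorm_pos_le) (simp add: linear_conv_bounded_linear)

lemma f_bound: "norm (f u - f v) \<le> L * norm (u - v)"
  using lipschitz_onD[OF lip, of u v] by (simp add: dist_norm)

lemma F_has_derivative: "(F has_derivative (\<lambda>h. h \<bullet> f u)) (at u)"
  using grad[of u] by (simp add: gderiv_def)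

lemma isCont_F: "isCont F u"
  using F_has_derivative by (rule has_derivative_continuous)

lemma isCont_f: "isCont f u"
  using lipschitz_on_continuous_on[OF lip] by (simp add: continuous_on_eq_continuous_at)

lemma isCont_M: "isCont M u"
  using linear_M by (simp add: linear_conv_bounded_linear linear_continuous_at)

lemma grad_F_step: "grad (F_step F f \<alpha> \<delta>t u v w) u = explicit_gradient u v w"
proof (rule grad_eqI)
  show "GDERIV (F_step F f \<alpha> \<delta>t u v w) u :> explicit_gradient u v w"
    unfolding gderiv_def F_step_def power2_norm_eq_inner
    by (rule derivative_eq_intros F_has_derivative refl)+
      (auto simp: explicit_gradient_def inner_diff_right inner_add_right fun_eq_iff inner_commute
        algebra_simps add_divide_distrib diff_divide_distrib)
qed

lemma is_subgradient_step:
  assumes step: "is_step \<theta> u v w x"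
  shows "is_subgradient H (step_subgradient \<theta> u v w x) x"
proof -
  interpret M: linear M by (rule linear_M)
  define y where "y = u + \<theta> *\<^sub>R (u - v)"
  define q where "q p = 1 / \<delta>t * (norm (p - u))\<^sup>2 - explicit_gradient u v w \<bullet> p
      + 1 / 2 * sq_seminorm M (p - y)" for p
  have obj: "step_objective H F f M \<alpha> \<delta>t \<theta> u v w p = H p + ereal (q p)" for p
    by (cases "H p")
      (auto simp: step_objective_def H_step_def grad_F_step q_def y_def)
  have min: "H x + ereal (q x) \<le> H p + ereal (q p)" for p
    using step unfolding is_step_def is_arg_min_def obj by (simp add: not_less)
  obtain p where "H p \<noteq> \<infinity>" using proper by (auto simp: proper_fun_def)
  then have "H x + ereal (q x) < \<infinity>" using min[of p] by (cases "H p") auto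
  then have fin: "\<bar>H x\<bar> \<noteq> \<infinity>" using H_not_MInf[of x] by (cases "H x") auto
  have M_der: "(M has_derivative M) (at z)" for z
    using linear_M by (simp add: bounded_linear_imp_has_derivative linear_conv_bounded_linear)
  have "((\<lambda>p. M (p - y)) has_derivative M) (at x)"
    by (rule has_derivative_compose[OF _ M_der, of "\<lambda>p. p - y" "\<lambda>h. h", simplified])
      (auto intro!: derivative_eq_intros)
  note M_der' = this
  have "(q has_derivative (\<lambda>h. 1 / \<delta>t * (2 * ((x - u) \<bullet> h)) - explicit_gradient u v w \<bullet> h
      + 1 / 2 * (M (x - y) \<bullet> h + M h \<bullet> (x - y)))) (at x)"
    unfolding q_def power2_norm_eq_inner sq_seminorm_def
    by (rule derivative_eq_intros M_der' refl)+ (simp add: fun_eq_iff inner_commute)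
  then have "GDERIV q x :> (2 / \<delta>t) *\<^sub>R (x - u) - explicit_gradient u v w + M (x - y)"
    unfolding gderiv_def M_sym[of _ "x - y"]
    by (simp add: inner_add_right inner_diff_right inner_commute algebra_simps)
  from subgradient_of_minimiser[OF convex H_not_MInf fin min this]
  show ?thesis by (simp add: step_subgradient_def y_def algebra_simps)
qed

text \<open>
The subgradient inequality at the previous iterate \<open>u\<close>, together with the quadratic upper
bound for \<open>F\<close>, bounds the increment of \<open>E\<close> by \<open>- 2 / \<delta>t + L / 2\<close> times
\<open>\<parallel>x - u\<parallel>\<^sup>2\<close> plus cross terms.  After the cross terms are split, the coefficients of
\<open>\<parallel>u - v\<parallel>\<^sup>2\<close> and \<open>\<parallel>v - w\<parallel>\<^sup>2\<close> are \<open>a - b\<close> and \<open>b\<close>, so these terms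
telescope in \<open>A\<close>.  The inequality is one between extended reals because \<open>H\<close> may be
infinite at the starting point.
\<close>
lemma sufficient_decrease:
  assumes step: "is_step \<theta> u v w x" and \<theta>: "0 \<le> \<theta>" "\<theta> \<le> 1"
  shows "A (x, u, v) + ereal (decay * (norm (x - u))\<^sup>2) \<le> A (u, v, w)"
proof -
  interpret M: linear M by (rule linear_M)
  define d d' d'' where d_def: "d = x - u" and d'_def: "d' = u - v" and d''_def: "d'' = v - w"
  have sub: "is_subgradient H (step_subgradient \<theta> u v w x) x"
    using step by (rule is_subgradient_step)
  then obtain r where r: "H x = ereal r" by (auto simp: is_subgradient_def)
  show ?thesis
  proof (cases "H u")
    case (real s)
    \<comment> \<open>A common unit for the step-size coefficients keeps the final estimate linear in the products below.\<close>
    define \<kappa> where "\<kappa> = 1 / (11 * \<delta>t)"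
    have \<kappa>: "14 / (11 * \<delta>t) = 14 * \<kappa>" "4 / (11 * \<delta>t) = 4 * \<kappa>" "2 / \<delta>t = 22 * \<kappa>"
      "9 / (11 * \<delta>t) = 9 * \<kappa>" "2 / (11 * \<delta>t) = 2 * \<kappa>" by (simp_all add: \<kappa>_def)
    have \<kappa>_pos: "0 < \<kappa>" using dt_pos by (simp add: \<kappa>_def)
    define N N' N'' where N: "N = (norm d)\<^sup>2" "N' = (norm d')\<^sup>2" "N'' = (norm d'')\<^sup>2"
    have sub_le: "r + step_subgradient \<theta> u v w x \<bullet> (u - x) \<le> s"
      using is_subgradientD[OF sub, of u] r real by simp
    have expand: "step_subgradient \<theta> u v w x \<bullet> (u - x)
        = - 14 * (\<kappa> * (d' \<bullet> d)) + 4 * (\<kappa> * (d'' \<bullet> d)) + f u \<bullet> d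
          + 2 * ((f u - f v) \<bullet> d) - (f v - f w) \<bullet> d + 22 * (\<kappa> * N)
          + sq_seminorm M d - \<theta> * (M d' \<bullet> d)"
    proof -
      have 1: "u - x = - d" "x - (u + \<theta> *\<^sub>R (u - v)) = d - \<theta> *\<^sub>R d'"
        by (simp_all add: d_def d'_def)
      show ?thesis unfolding step_subgradient_def explicit_gradient_def 1 M.diff M.scale \<kappa>
        by (simp add: inner_diff_left inner_add_left power2_norm_eq_inner sq_seminorm_def N
            flip: d_def d'_def d''_def)
    qed
    have F_le: "F x \<le> F u + f u \<bullet> d + L / 2 * N"
      unfolding d_def N by (rule descent_lemma_upper[OF grad lip])
    have M_le: "\<theta> * (M d' \<bullet> d) \<le> 1 / 2 * sq_seminorm M d + 1 / 2 * sq_seminorm M d'"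
      by (rule sq_seminorm_scale_gap[OF psd \<theta>])
    have "\<kappa> * (d' \<bullet> d) \<le> \<kappa> * ((N' + N) / 2)"
      unfolding N using \<kappa>_pos by (intro mult_left_mono inner_le_half_squares) auto
    then have i1: "\<kappa> * (d' \<bullet> d) \<le> 1 / 2 * (\<kappa> * N') + 1 / 2 * (\<kappa> * N)"
      by (simp add: algebra_simps)
    have "\<kappa> * (- d'' \<bullet> d) \<le> \<kappa> * ((N'' + N) / 2)"
      unfolding N using \<kappa>_pos inner_le_half_squares[of "- d''" d] by (intro mult_left_mono) auto
    then have i2: "- (\<kappa> * (d'' \<bullet> d)) \<le> 1 / 2 * (\<kappa> * N'') + 1 / 2 * (\<kappa> * N)"
      by (simp add: algebra_simps)
    have lip_term: "\<bar>(f p - f q) \<bullet> d\<bar> \<le> 1 / 2 * (L * (norm (p - q))\<^sup>2) + 1 / 2 * (L * N)" for p q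
    proof -
      have "\<bar>(f p - f q) \<bullet> d\<bar> \<le> norm (f p - f q) * norm d" by (rule Cauchy_Schwarz_ineq2)
      also have "\<dots> \<le> L * norm (p - q) * norm d" by (intro mult_right_mono f_bound) auto
      also have "\<dots> = L * (norm (p - q) * norm d)" by simp
      also have "\<dots> \<le> L * (((norm (p - q))\<^sup>2 + (norm d)\<^sup>2) / 2)"
        using sum_squares_bound[of "norm (p - q)" "norm d"] L_pos by (intro mult_left_mono) auto
      finally show ?thesis by (simp add: N algebra_simps)
    qed
    have l1: "\<bar>(f u - f v) \<bullet> d\<bar> \<le> 1 / 2 * (L * N') + 1 / 2 * (L * N)"
      using lip_term[of u v] by (simp add: d'_def N)
    have l2: "\<bar>(f v - f w) \<bullet> d\<bar> \<le> 1 / 2 * (L * N'') + 1 / 2 * (L * N)"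
      using lip_term[of v w] by (simp add: d''_def N)
    have "r + F x + 13 * (\<kappa> * N) - 2 * (L * N) + 2 * (\<kappa> * N') + 1 / 2 * (L * N') + 1 / 2 * sq_seminorm M d
        \<le> s + F u + 9 * (\<kappa> * N') + 3 / 2 * (L * N') + 2 * (\<kappa> * N'') + 1 / 2 * (L * N'')
          + 1 / 2 * sq_seminorm M d'"
      using sub_le F_le M_le i1 i2 l1 l2 unfolding expand by linarith
    then have "r + F x + (a * N + b * N' + 1 / 2 * sq_seminorm M d) + decay * N
        \<le> s + F u + (a * N' + b * N'' + 1 / 2 * sq_seminorm M d')"
      unfolding \<kappa> by (simp add: algebra_simps)
    then show ?thesis
      unfolding aux_energy_def energy_def prod.case r real by (simp add: d_def d'_def d''_def N)
  next
    case PInf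
    then show ?thesis by (simp add: aux_energy_def energy_def)
  next
    case MInf
    then show ?thesis using H_not_MInf by simp
  qed
qed

lemma frechet_subdiff_E:
  assumes "is_subgradient H \<xi> x"
  shows "\<xi> + f x \<in> frechet_subdiff E x"
proof (rule frechet_subdiffI_quadratic[where K = "L / 2"])
  obtain r where r: "H x = ereal r" using assms by (auto simp: is_subgradient_def)
  then show "\<bar>E x\<bar> \<noteq> \<infinity>" by (simp add: energy_def)
  fix y
  show "E x + ereal ((\<xi> + f x) \<bullet> (y - x) - L / 2 * (norm (y - x))\<^sup>2) \<le> E y"
  proof (cases "H y")
    case (real s)
    have "r + \<xi> \<bullet> (y - x) \<le> s"
      using is_subgradientD[OF assms, of y] r real by simp
    then show ?thesis using descent_lemma_lower[OF grad lip, of x y] r real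
      by (simp add: energy_def inner_add_left)
  qed (use H_not_MInf in \<open>auto simp: energy_def\<close>)
qed

text \<open>
The quadratic terms of \<open>A\<close> are convex, so each lies above its tangent; only the error of
\<open>F\<close> is left over.
\<close>
lemma frechet_subdiff_A:
  assumes "is_subgradient H \<xi> x"
  shows "(\<xi> + f x + (2 * a) *\<^sub>R (x - u) + M (x - u),
          - ((2 * a) *\<^sub>R (x - u)) + (2 * b) *\<^sub>R (u - v) - M (x - u),
          - ((2 * b) *\<^sub>R (u - v))) \<in> frechet_subdiff A (x, u, v)" (is "?p \<in> _")
proof (rule frechet_subdiffI_quadratic[where K = "L / 2"])
  obtain r where r: "H x = ereal r" using assms by (auto simp: is_subgradient_def)
  then show "\<bar>A (x, u, v)\<bar> \<noteq> \<infinity>" by (simp add: aux_energy_def energy_def)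
  fix y :: "'a \<times> 'a \<times> 'a"
  obtain x' u' v' where y: "y = (x', u', v')" by (cases y)
  show "A (x, u, v) + ereal (?p \<bullet> (y - (x, u, v)) - L / 2 * (norm (y - (x, u, v)))\<^sup>2) \<le> A y"
  proof (cases "H x'")
    case (real s)
    define d e d' e' where ds: "d = x - u" "e = x' - u'" "d' = u - v" "e' = u' - v'"
    have "r + \<xi> \<bullet> (x' - x) \<le> s"
      using is_subgradientD[OF assms, of x'] r real by simp
    moreover have "F x + f x \<bullet> (x' - x) - L / 2 * (norm (x' - x))\<^sup>2 \<le> F x'"
      by (rule descent_lemma_lower[OF grad lip])
    moreover have "L / 2 * (norm (x' - x))\<^sup>2 \<le> L / 2 * (norm (y - (x, u, v)))\<^sup>2"
      unfolding y using norm_fst_le[of "x' - x" "(u' - u, v' - v)"] L_pos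
      by (intro mult_left_mono power_mono) auto
    moreover have "a * ((norm d)\<^sup>2 + 2 * (d \<bullet> (e - d))) \<le> a * (norm e)\<^sup>2"
      using dt_pos L_pos by (intro mult_left_mono norm_sq_tangent) auto
    moreover have "b * ((norm d')\<^sup>2 + 2 * (d' \<bullet> (e' - d'))) \<le> b * (norm e')\<^sup>2"
      using dt_pos L_pos by (intro mult_left_mono norm_sq_tangent) auto
    moreover have "sq_seminorm M d + 2 * (M d \<bullet> (e - d)) \<le> sq_seminorm M e"
      by (rule sq_seminorm_tangent[OF psd])
    moreover have "?p \<bullet> (y - (x, u, v)) = \<xi> \<bullet> (x' - x) + f x \<bullet> (x' - x)
        + a * (2 * (d \<bullet> (e - d))) + b * (2 * (d' \<bullet> (e' - d'))) + M d \<bullet> (e - d)"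
      unfolding y ds by (simp add: inner_diff_left inner_add_left inner_diff_right algebra_simps)
    ultimately have "r + F x + (a * (norm d)\<^sup>2 + b * (norm d')\<^sup>2 + 1 / 2 * sq_seminorm M d)
        + (?p \<bullet> (y - (x, u, v)) - L / 2 * (norm (y - (x, u, v)))\<^sup>2)
      \<le> s + F x' + (a * (norm e)\<^sup>2 + b * (norm e')\<^sup>2 + 1 / 2 * sq_seminorm M e)"
      unfolding distrib_left[of a] distrib_left[of b] by linarith
    then show ?thesis
      unfolding y aux_energy_def energy_def prod.case r real ds by simp
  qed (use H_not_MInf y in \<open>auto simp: aux_energy_def energy_def\<close>)
qed

definition "residual_const = 40 / (11 * \<delta>t) + 4 * L + 2 * onorm M"

definition "gap_const = residual_const + 4 * a + 4 * b + 2 * onorm M"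

text \<open>
Adding \<open>f x\<close> completes the one undifferenced value of \<open>f\<close>, so that the sum depends
linearly on the increments of the iterates and of \<open>f\<close>.
\<close>
lemma residual_bound:
  assumes \<theta>: "0 \<le> \<theta>" "\<theta> \<le> 1"
  shows "norm (step_subgradient \<theta> u v w x + f x)
     \<le> residual_const * (norm (x - u) + norm (u - v) + norm (v - w))"
proof -
  interpret M: linear M by (rule linear_M)
  define S where "S = norm (x - u) + norm (u - v) + norm (v - w)"
  have S: "norm (x - u) \<le> S" "norm (u - v) \<le> S" "norm (v - w) \<le> S" by (auto simp: S_def)
  have fS: "norm (f p - f q) \<le> L * S" if "norm (p - q) \<le> S" for p q
    using f_bound[of p q] mult_left_mono[OF that, of L] L_pos by linarith
  have MS: "norm (M p) \<le> onorm M * S" if "norm p \<le> S" for p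
    using M_bound[of p] mult_left_mono[OF that onorm_M_nonneg] by linarith
  have eq: "step_subgradient \<theta> u v w x + f x =
      (14 / (11 * \<delta>t)) *\<^sub>R (u - v) - (4 / (11 * \<delta>t)) *\<^sub>R (v - w) + (f x - f u)
      - 2 *\<^sub>R (f u - f v) + (f v - f w) - (2 / \<delta>t) *\<^sub>R (x - u) - M (x - u) + M (\<theta> *\<^sub>R (u - v))"
    unfolding step_subgradient_def explicit_gradient_def
    by (simp add: M.diff M.add)
  have "norm (\<theta> *\<^sub>R (u - v)) \<le> norm (u - v)" using \<theta> by (simp add: mult_left_le_one_le)
  then have "norm (M (\<theta> *\<^sub>R (u - v))) \<le> onorm M * S" using S by (intro MS) linarith
  moreover have "norm (M (x - u)) \<le> onorm M * S" using S by (intro MS)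
  moreover have "norm (f x - f u) \<le> L * S" "norm (f v - f w) \<le> L * S" using S by (auto intro: fS)
  moreover have "norm (2 *\<^sub>R (f u - f v)) \<le> 2 * (L * S)" using fS[OF S(2)] by simp
  moreover have "norm ((14 / (11 * \<delta>t)) *\<^sub>R (u - v)) \<le> 14 / (11 * \<delta>t) * S"
    "norm ((4 / (11 * \<delta>t)) *\<^sub>R (v - w)) \<le> 4 / (11 * \<delta>t) * S"
    "norm ((2 / \<delta>t) *\<^sub>R (x - u)) \<le> 2 / \<delta>t * S"
    using dt_pos by (intro norm_scaleR_le S; simp)+
  moreover have "norm (step_subgradient \<theta> u v w x + f x) \<le>
      norm ((14 / (11 * \<delta>t)) *\<^sub>R (u - v)) + norm ((4 / (11 * \<delta>t)) *\<^sub>R (v - w)) + norm (f x - f u)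
      + norm (2 *\<^sub>R (f u - f v)) + norm (f v - f w) + norm ((2 / \<delta>t) *\<^sub>R (x - u))
      + norm (M (x - u)) + norm (M (\<theta> *\<^sub>R (u - v)))"
    unfolding eq by (intro norm_triangle_mono norm_triangle_le norm_triangle_le_diff add_mono order_refl)
  ultimately have "norm (step_subgradient \<theta> u v w x + f x) \<le>
      14 / (11 * \<delta>t) * S + 4 / (11 * \<delta>t) * S + 2 / \<delta>t * S + 4 * (L * S) + 2 * (onorm M * S)"
    by linarith
  also have "\<dots> = residual_const * S"
    using dt_pos by (simp add: residual_const_def field_simps)
  finally show ?thesis by (simp add: S_def)
qed

lemma relative_error:
  assumes step: "is_step \<theta> u v w x" and \<theta>: "0 \<le> \<theta>" "\<theta> \<le> 1"
  obtains p where "p \<in> frechet_subdiff A (x, u, v)"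
    "norm p \<le> gap_const * (norm (x - u) + norm (u - v) + norm (v - w))"
proof -
  define S where "S = norm (x - u) + norm (u - v) + norm (v - w)"
  have S: "norm (x - u) \<le> S" "norm (u - v) \<le> S" by (auto simp: S_def)
  have ab: "0 \<le> a" "0 \<le> b" using dt_pos L_pos by auto
  define \<eta> where "\<eta> = step_subgradient \<theta> u v w x + f x"
  have \<eta>: "norm \<eta> \<le> residual_const * S" unfolding \<eta>_def S_def by (rule residual_bound[OF \<theta>])
  have m: "norm (M (x - u)) \<le> onorm M * S"
    using M_bound[of "x - u"] mult_left_mono[OF S(1) onorm_M_nonneg] by linarith
  have ka: "norm ((2 * a) *\<^sub>R (x - u)) \<le> 2 * (a * S)"
    by (subst mult.assoc[symmetric],
        rule norm_scaleR_le[OF mult_nonneg_nonneg[OF zero_le_numeral ab(1)] S(1)])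
  have kb: "norm ((2 * b) *\<^sub>R (u - v)) \<le> 2 * (b * S)"
    by (subst mult.assoc[symmetric],
        rule norm_scaleR_le[OF mult_nonneg_nonneg[OF zero_le_numeral ab(2)] S(2)])
  let ?p1 = "\<eta> + (2 * a) *\<^sub>R (x - u) + M (x - u)"
  let ?p2 = "- ((2 * a) *\<^sub>R (x - u)) + (2 * b) *\<^sub>R (u - v) - M (x - u)"
  let ?p3 = "- ((2 * b) *\<^sub>R (u - v))"
  have "norm ?p1 \<le> residual_const * S + 2 * (a * S) + onorm M * S"
    by (intro norm_triangle_mono \<eta> m ka)
  moreover have "norm ?p2 \<le> 2 * (a * S) + 2 * (b * S) + onorm M * S"
    using norm_triangle_ineq4[of "- ((2 * a) *\<^sub>R (x - u)) + (2 * b) *\<^sub>R (u - v)" "M (x - u)"]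
      norm_triangle_ineq[of "- ((2 * a) *\<^sub>R (x - u))" "(2 * b) *\<^sub>R (u - v)"] m ka kb
    unfolding norm_minus_cancel by linarith
  moreover have "norm ?p3 \<le> 2 * (b * S)" unfolding norm_minus_cancel by (rule kb)
  moreover have "norm (?p1, ?p2, ?p3) \<le> norm ?p1 + (norm ?p2 + norm ?p3)"
    using norm_Pair_le[of ?p1 "(?p2, ?p3)"] norm_Pair_le[of ?p2 ?p3] by linarith
  moreover have "gap_const * S = residual_const * S + 2 * (a * S) + onorm M * S
      + (2 * (a * S) + 2 * (b * S) + onorm M * S + 2 * (b * S))"
    by (simp add: gap_const_def algebra_simps)
  ultimately have "norm (?p1, ?p2, ?p3) \<le> gap_const * S" by linarith
  then show ?thesis
    using frechet_subdiff_A[OF is_subgradient_step[OF step], of u v] that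
    unfolding \<eta>_def S_def by blast
qed

end

section \<open>Finite length from the KL inequality\<close>

lemma concave_on_tangent:
  fixes \<psi> :: "real \<Rightarrow> real"
  assumes conc: "concave_on I \<psi>" and "connected I" and "s \<in> interior I" and "t \<in> I"
    and der: "(\<psi> has_real_derivative m) (at s)"
  shows "\<psi> t \<le> \<psi> s + m * (t - s)"
proof -
  have "((\<lambda>t. - \<psi> t) has_real_derivative - m) (at s within I)"
    by (rule has_field_derivative_at_within[OF DERIV_minus[OF der]])
  with assms have "- \<psi> t - (- \<psi> s) \<ge> (- m) * (t - s)"
    by (intro convex_on_imp_above_tangent[of I]) (auto simp: concave_on_def)
  then show ?thesis by simp
qed

text \<open>
The abstract mechanism, stated for a sequence of points and a sequence \<open>e\<close> of values above
their limit.  Concavity of \<open>\<psi>\<close> and the KL inequality give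
\<open>D(k+3)\<^sup>2 \<le> K (\<psi>(e k) - \<psi>(e (k+1))) S\<close> with \<open>S\<close> the sum of the three preceding
step lengths, hence
\<open>D(k+3) \<le> (3/2) K (\<psi>(e k) - \<psi>(e (k+1))) + S/6\<close>.  With this in hand the potential \<open>V\<close>
decreases by at least \<open>D(k+3)\<close>, as long as the three points involved stay near \<open>xb\<close>.
The sum of \<open>dist (z (k+3)) xb\<close> and \<open>V k\<close> is then nonincreasing by the triangle
inequality, which is why the sequence never leaves the ball and one cluster point suffices.
\<close>
lemma KL_finite_length:
  fixes z :: "nat \<Rightarrow> 'a::real_normed_vector" and e :: "nat \<Rightarrow> real" and \<nu> :: ereal
  defines "D \<equiv> \<lambda>k. norm (z (k + 1) - z k)" and "I \<equiv> {t. 0 \<le> t \<and> ereal t < \<nu>}"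
  assumes c: "0 < c" and C: "0 \<le> C" and \<rho>: "0 < \<rho>" and \<nu>: "0 < \<nu>"
    and decrease: "\<And>k. e (k + 1) + c * (D (k + 3))\<^sup>2 \<le> e k"
    and e_pos: "\<And>k. 0 < e k" and e_lim: "e \<longlonglongrightarrow> 0"
    and cont: "continuous_on I \<psi>" and conc: "concave_on I \<psi>"
    and \<psi>_nonneg: "\<And>t. t \<in> I \<Longrightarrow> 0 \<le> \<psi> t" and \<psi>_0: "\<psi> 0 = 0"
    and der: "\<And>t. 0 < t \<Longrightarrow> ereal t < \<nu> \<Longrightarrow> (\<psi> has_real_derivative \<psi>' t) (at t)"
    and KL: "\<And>k. dist (z (k + 1)) xb < \<rho> \<Longrightarrow> dist (z (k + 2)) xb < \<rho> \<Longrightarrow> dist (z (k + 3)) xb < \<rho> \<Longrightarrow>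
       ereal (e k) < \<nu> \<Longrightarrow> 1 \<le> \<psi>' (e k) * (C * (D (k + 2) + D (k + 1) + D k))"
    and cluster: "\<And>\<epsilon> N. 0 < \<epsilon> \<Longrightarrow> \<exists>n\<ge>N. dist (z n) xb < \<epsilon>"
  shows "summable D"
proof -
  define K where "K = C / c"
  have K: "0 \<le> K" using c C by (simp add: K_def)
  have D_nonneg [simp]: "0 \<le> D k" for k by (simp add: D_def)
  have I_interval: "connected I"
    unfolding is_interval_connected_1[symmetric] is_interval_1
  proof (intro ballI allI impI)
    fix p q t assume pq: "p \<in> I" "q \<in> I" "p \<le> t \<and> t \<le> q"
    then have "ereal t \<le> ereal q" "ereal q < \<nu>" by (simp_all add: I_def)
    then have "ereal t < \<nu>" by (rule le_less_trans)
    then show "t \<in> I" using pq by (simp add: I_def)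
  qed
  have I_interior: "t \<in> interior I" if t: "0 < t" "ereal t < \<nu>" for t
  proof -
    obtain q where q: "ereal t < ereal q" "ereal q < \<nu>" using ereal_dense2[OF t(2)] by blast
    have "{0<..<q} \<subseteq> I"
    proof
      fix s assume s: "s \<in> {0<..<q}"
      then have "ereal s < ereal q" by simp
      from less_trans[OF this q(2)] show "s \<in> I" using s by (simp add: I_def)
    qed
    then show ?thesis using t q by (intro interiorI[of "{0<..<q}"]) auto
  qed
  have e_mem: "e k \<in> I" if "ereal (e k) < \<nu>" for k
    using that e_pos[of k] by (simp add: I_def)

  have "ereal 0 < \<nu>" using \<nu> by (simp flip: zero_ereal_def)
  moreover have "(\<lambda>k. ereal (e k)) \<longlonglongrightarrow> ereal 0" using e_lim by simp
  ultimately have ev_\<nu>: "\<forall>\<^sub>F k in sequentially. ereal (e k) < \<nu>" by (rule order_tendstoD(2)[rotated])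
  have \<psi>_lim: "(\<lambda>k. \<psi> (e k)) \<longlonglongrightarrow> 0"
  proof -
    have "0 \<in> I" using \<nu> by (simp add: I_def flip: zero_ereal_def)
    then have "(\<lambda>k. \<psi> (e k)) \<longlonglongrightarrow> \<psi> 0"
      by (rule continuous_on_tendsto_compose[OF cont e_lim]) (rule eventually_mono[OF ev_\<nu> e_mem])
    then show ?thesis by (simp add: \<psi>_0)
  qed
  have D_lim: "D \<longlonglongrightarrow> 0"
  proof -
    have "(\<lambda>k. (D (k + 3))\<^sup>2) \<longlonglongrightarrow> 0"
    proof (rule real_tendsto_sandwich[of "\<lambda>_. 0" _ _ "\<lambda>k. e k / c"])
      have "(D (k + 3))\<^sup>2 \<le> e k / c" for k
        using decrease[of k] e_pos[of "k + 1"] c by (simp add: field_simps)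
      then show "\<forall>\<^sub>F k in sequentially. (D (k + 3))\<^sup>2 \<le> e k / c" by simp
      show "(\<lambda>k. e k / c) \<longlonglongrightarrow> 0" using e_lim tendsto_divide_zero by blast
    qed auto
    then have "(\<lambda>k. sqrt ((D (k + 3))\<^sup>2)) \<longlonglongrightarrow> sqrt 0" by (rule tendsto_real_sqrt)
    then have "(\<lambda>k. D (k + 3)) \<longlonglongrightarrow> 0" by simp
    then show ?thesis by (rule LIMSEQ_offset[of D 3])
  qed

  \<comment> \<open>The weights 1, 2/3, 1/3 solve the requirement that twice the bound on D(k+3) is absorbed: consecutive weights differ by 2 * (1/6).\<close>
  define V where "V k = D (k + 2) + 2 / 3 * D (k + 1) + 1 / 3 * D k + 3 * K * \<psi> (e k)" for k
  have V_nonneg: "0 \<le> V k" if "ereal (e k) < \<nu>" for k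
    using \<psi>_nonneg[OF e_mem[OF that]] K by (simp add: V_def)
  have V_step: "D (k + 3) + V (k + 1) \<le> V k"
    if near: "dist (z (k + 1)) xb < \<rho>" "dist (z (k + 2)) xb < \<rho>" "dist (z (k + 3)) xb < \<rho>"
      and small: "ereal (e k) < \<nu>" for k
  proof -
    define S where "S = D (k + 2) + D (k + 1) + D k"
    define \<Delta> where "\<Delta> = \<psi> (e k) - \<psi> (e (k + 1))"
    have "0 \<le> c * (D (k + 3))\<^sup>2" using c by simp
    with decrease[of k] have mono: "e (k + 1) \<le> e k" by linarith
    then have small': "ereal (e (k + 1)) < \<nu>" using small le_less_trans[of "ereal (e (k + 1))" "ereal (e k)" \<nu>] by simp
    have KLk: "1 \<le> \<psi>' (e k) * (C * S)" unfolding S_def by (rule KL[OF near small])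
    have S: "0 \<le> S" by (simp add: S_def)
    have \<psi>'_pos: "0 < \<psi>' (e k)"
    proof (rule ccontr)
      assume "\<not> ?thesis"
      then have "\<psi>' (e k) * (C * S) \<le> 0" using C S by (intro mult_nonpos_nonneg) auto
      with KLk show False by simp
    qed
    have "\<psi> (e (k + 1)) \<le> \<psi> (e k) + \<psi>' (e k) * (e (k + 1) - e k)"
      by (rule concave_on_tangent[OF conc I_interval I_interior[OF e_pos small] e_mem[OF small'] der[OF e_pos small]])
    moreover have "\<psi>' (e k) * (c * (D (k + 3))\<^sup>2) \<le> \<psi>' (e k) * (e k - e (k + 1))"
      using decrease[of k] \<psi>'_pos by (intro mult_left_mono) auto
    ultimately have \<Delta>: "\<psi>' (e k) * (c * (D (k + 3))\<^sup>2) \<le> \<Delta>" by (simp add: \<Delta>_def algebra_simps)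
    have "c * (D (k + 3))\<^sup>2 * 1 \<le> c * (D (k + 3))\<^sup>2 * (\<psi>' (e k) * (C * S))"
      using c by (intro mult_left_mono KLk) auto
    also have "\<dots> = C * S * (\<psi>' (e k) * (c * (D (k + 3))\<^sup>2))" by simp
    also have "\<dots> \<le> C * S * \<Delta>" using C S by (intro mult_left_mono \<Delta>) auto
    finally have sq: "(D (k + 3))\<^sup>2 \<le> K * \<Delta> * S" using c by (simp add: K_def field_simps)
    have "0 \<le> \<psi>' (e k) * (c * (D (k + 3))\<^sup>2)" using \<psi>'_pos c by simp
    with \<Delta> have \<Delta>_nonneg: "0 \<le> \<Delta>" by linarith
    have "(D (k + 3))\<^sup>2 \<le> (3 / 2 * (K * \<Delta>) + S / 6)\<^sup>2"
    proof -
      have "(3 / 2 * (K * \<Delta>) + S / 6)\<^sup>2 = (3 / 2 * (K * \<Delta>) - S / 6)\<^sup>2 + K * \<Delta> * S"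
        by (simp add: power2_eq_square algebra_simps)
      moreover have "0 \<le> (3 / 2 * (K * \<Delta>) - S / 6)\<^sup>2" by simp
      ultimately show ?thesis using sq by linarith
    qed
    then have "D (k + 3) \<le> 3 / 2 * (K * \<Delta>) + S / 6"
      by (rule power2_le_imp_le) (use K \<Delta>_nonneg S in auto)
    moreover have "K * \<Delta> = K * \<psi> (e k) - K * \<psi> (e (k + 1))" by (simp add: \<Delta>_def algebra_simps)
    moreover have "V k = D (k + 2) + 2 / 3 * D (k + 1) + 1 / 3 * D k + 3 * (K * \<psi> (e k))"
      "V (k + 1) = D (k + 3) + 2 / 3 * D (k + 2) + 1 / 3 * D (k + 1) + 3 * (K * \<psi> (e (k + 1)))"
      by (simp_all add: V_def numeral_3_eq_3)
    ultimately show ?thesis unfolding S_def by argo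
  qed

  have "V \<longlonglongrightarrow> 0 + 2 / 3 * 0 + 1 / 3 * 0 + 3 * K * 0"
    unfolding V_def by (intro tendsto_add tendsto_mult tendsto_const \<psi>_lim D_lim D_lim[THEN LIMSEQ_ignore_initial_segment])
  then have ev_V: "\<forall>\<^sub>F k in sequentially. V k < \<rho> / 4"
    by (rule order_tendstoD) (use \<rho> in simp)
  have ev_D: "\<forall>\<^sub>F k in sequentially. D k < \<rho> / 4"
    using D_lim by (rule order_tendstoD) (use \<rho> in simp)
  obtain N0 where N0: "\<And>k. k \<ge> N0 \<Longrightarrow> V k < \<rho> / 4 \<and> D k < \<rho> / 4 \<and> ereal (e k) < \<nu>"
    using eventually_conj[OF ev_V eventually_conj[OF ev_D ev_\<nu>]] unfolding eventually_sequentially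
    by blast
  obtain N where N: "N \<ge> N0" and N_near: "dist (z (N + 1)) xb < \<rho> / 4"
  proof -
    obtain n where n: "n \<ge> N0 + 1" "dist (z n) xb < \<rho> / 4" using cluster[of "\<rho> / 4" "N0 + 1"] \<rho> by auto
    then show ?thesis using that[of "n - 1"] by simp
  qed
  have move: "dist (z (k + 1)) xb \<le> dist (z k) xb + D k" for k
    using dist_triangle[of "z (k + 1)" xb "z k"] unfolding D_def dist_norm by simp
  have move2: "dist (z (N + 2)) xb \<le> dist (z (N + 1)) xb + D (N + 1)"
    using move[of "N + 1"] by (simp add: numeral_eq_Suc)
  have move3: "dist (z (N + 3)) xb \<le> dist (z (N + 2)) xb + D (N + 2)"
    using move[of "N + 2"] by (simp add: numeral_eq_Suc)
  have small: "D (N + 1) < \<rho> / 4" "D (N + 2) < \<rho> / 4" "V N < \<rho> / 4"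
    using N0[of "N + 1"] N0[of "N + 2"] N0[of N] N by auto
  have start: "dist (z (N + 2)) xb < \<rho>" using N_near move2 small(1) \<rho> by linarith
  have start': "dist (z (N + 3)) xb + V N < \<rho>"
    using N_near move2 move3 small by linarith
  have trapped: "dist (z (k + 3)) xb + V k < \<rho> \<and> dist (z (k + 1)) xb < \<rho> \<and> dist (z (k + 2)) xb < \<rho>"
    if "k \<ge> N" for k
    using that
  proof (induction k rule: dec_induct)
    case base
    then show ?case using start start' N_near \<rho> by simp
  next
    case (step k)
    have V0: "0 \<le> V k" using N0[of k] step N by (intro V_nonneg) auto
    then have "D (k + 3) + V (k + 1) \<le> V k"
      using step N0[of k] N by (intro V_step) auto
    moreover have "dist (z (k + 4)) xb \<le> dist (z (k + 3)) xb + D (k + 3)"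
      using move[of "k + 3"] by (simp add: numeral_eq_Suc)
    ultimately show ?case using step V0 by (simp add: numeral_eq_Suc)
  qed
  have step: "D (k + 3) + V (k + 1) \<le> V k" and Vk: "0 \<le> V k" if "k \<ge> N" for k
  proof -
    show "0 \<le> V k" using N0[of k] that N by (intro V_nonneg) auto
    then show "D (k + 3) + V (k + 1) \<le> V k"
      using trapped[OF that] N0[of k] that N by (intro V_step) auto
  qed
  have sum_V: "(\<Sum>i<n. D (i + (N + 3))) + V (n + N) \<le> V N" for n
  proof (induction n)
    case (Suc n)
    have "D (n + (N + 3)) + V (Suc n + N) \<le> V (n + N)"
      using step[of "n + N"] by (simp add: add.assoc)
    with Suc show ?case unfolding sum.lessThan_Suc by linarith
  qed simp
  have bound: "(\<Sum>i<n. D (i + (N + 3))) \<le> V N" for n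
    using Vk[of "n + N"] sum_V[of n] by simp
  have "summable (\<lambda>i. D (i + (N + 3)))"
    by (rule summableI_nonneg_bounded[where x = "V N"]) (rule D_nonneg, rule bound)
  then show ?thesis by (rule summable_iff_shift[of D "N + 3", THEN iffD1])
qed

section \<open>The iteration\<close>

text \<open>
Here \<open>z k\<close> stands for the iterate with index \<open>k - 1\<close>, so that the three starting points
are \<open>z 0\<close>, \<open>z 1\<close>, \<open>z 2\<close> and no negative index occurs.  The points
\<open>z (k + 3)\<close> are the ones produced by a minimisation, and only these are known to lie in the
domain of \<open>H\<close>.
\<close>
locale bdf_iteration = bdf_scheme +
  fixes \<beta> :: "nat \<Rightarrow> real" and z :: "nat \<Rightarrow> 'a"
  assumes \<beta>: "\<And>k. 0 \<le> \<beta> k" "\<And>k. \<beta> k \<le> 1"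
    and step: "\<And>k. is_step (\<beta> k) (z (k + 2)) (z (k + 1)) (z k) (z (k + 3))"
begin

definition "D k = norm (z (k + 1) - z k)"

definition "T k = (z (k + 3), z (k + 2), z (k + 1))"

definition "\<xi> k = step_subgradient (\<beta> k) (z (k + 2)) (z (k + 1)) (z k) (z (k + 3))"

definition "h k = real_of_ereal (H (z (k + 3)))"

definition "value k = h k + F (z (k + 3))
  + (a * (D (k + 2))\<^sup>2 + b * (D (k + 1))\<^sup>2 + 1 / 2 * sq_seminorm M (z (k + 3) - z (k + 2)))"

lemma D_nonneg [simp]: "0 \<le> D k" by (simp add: D_def)

lemma D_shift: "norm (z (k + 3) - z (k + 2)) = D (k + 2)" "norm (z (k + 2) - z (k + 1)) = D (k + 1)"
  by (simp_all add: D_def numeral_eq_Suc)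

lemma subgradient_\<xi>: "is_subgradient H (\<xi> k) (z (k + 3))"
  unfolding \<xi>_def by (rule is_subgradient_step[OF step])

lemma H_z: "H (z (k + 3)) = ereal (h k)"
  using subgradient_\<xi>[of k] by (auto simp: is_subgradient_def h_def)

lemma A_T: "A (T k) = ereal (value k)"
  unfolding aux_energy_def energy_def T_def value_def prod.case H_z D_shift by simp

lemma E_z: "E (z (k + 3)) = ereal (h k + F (z (k + 3)))"
  by (simp add: energy_def H_z)

lemma E_le_value: "h k + F (z (k + 3)) \<le> value k"
  using dt_pos L_pos psd_operator_nonneg[OF psd] by (simp add: value_def sq_seminorm_def)

lemma A_antimono: "A (T k) \<le> A (z (k + 2), z (k + 1), z k)"
proof -
  have "A (T k) + 0 \<le> A (T k) + ereal (decay * (norm (z (k + 3) - z (k + 2)))\<^sup>2)"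
    using decay_pos by (intro add_left_mono) simp
  also have "\<dots> \<le> A (z (k + 2), z (k + 1), z k)"
    unfolding T_def by (rule sufficient_decrease[OF step \<beta>])
  finally show ?thesis by simp
qed

lemma value_decrease: "value (k + 1) + decay * (D (k + 3))\<^sup>2 \<le> value k"
proof -
  have idx: "k + 1 + 3 = k + 4" "k + 1 + 2 = k + 3" "k + 1 + 1 = k + 2" by simp_all
  have "A (T (k + 1)) + ereal (decay * (norm (z (k + 4) - z (k + 3)))\<^sup>2) \<le> A (T k)"
    using sufficient_decrease[OF step \<beta>, of "k + 1"] unfolding T_def idx .
  moreover have "norm (z (k + 4) - z (k + 3)) = D (k + 3)" by (simp add: D_def numeral_eq_Suc)
  ultimately show ?thesis unfolding A_T by simp
qed

lemma decseq_value: "decseq value"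
proof (rule decseq_SucI)
  fix k
  have "0 \<le> decay * (D (k + 3))\<^sup>2" using decay_pos by simp
  then show "value (Suc k) \<le> value k" using value_decrease[of k] by simp
qed

lemma bounded_z: "bounded (range z)"
proof -
  have "h k + F (z (k + 3)) \<le> value 0" for k
    using E_le_value[of k] decseqD[OF decseq_value, of 0 k] by simp
  then have "range (\<lambda>k. z (k + 3)) \<subseteq> {x. E x \<le> ereal (value 0)}" by (auto simp: E_z)
  then have "bounded (range (\<lambda>k. z (k + 3)))"
    using level unfolding level_bounded_def by (meson bounded_subset)
  moreover have "range z \<subseteq> z ` {..<3} \<union> range (\<lambda>k. z (k + 3))"
  proof
    fix p assume "p \<in> range z"
    then obtain n where "p = z n" by auto
    then show "p \<in> z ` {..<3} \<union> range (\<lambda>k. z (k + 3))"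
      by (cases "n < 3") (auto intro: range_eqI[of _ _ "n - 3"])
  qed
  ultimately show ?thesis
    by (meson bounded_Un bounded_subset finite_imageI finite_imp_bounded finite_lessThan)
qed

text \<open>
A single subgradient of \<open>H\<close> and the quadratic lower bound for \<open>F\<close>, both taken at the
first computed iterate, bound \<open>E\<close> from below on the bounded set of iterates.
\<close>
lemma value_bounded_below: "\<exists>B. \<forall>k. B \<le> value k"
proof -
  obtain R where R: "\<And>k. norm (z k) \<le> R" using bounded_z by (auto simp: bounded_iff)
  define p where "p = \<xi> 0 + f (z 3)"
  define B where "B = h 0 + F (z 3) - norm p * (2 * R) - L / 2 * (2 * R)\<^sup>2"
  have "B \<le> value k" for k
  proof -
    define d where "d = z (k + 3) - z 3"
    have d: "norm d \<le> 2 * R"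
      using norm_triangle_ineq4[of "z (k + 3)" "z 3"] R[of "k + 3"] R[of 3] by (simp add: d_def)
    have "h 0 + \<xi> 0 \<bullet> d \<le> h k"
      using is_subgradientD[OF subgradient_\<xi>[of 0], of "z (k + 3)"] H_z[of 0] H_z[of k]
      by (simp add: d_def)
    moreover have "F (z 3) + f (z 3) \<bullet> d - L / 2 * (norm d)\<^sup>2 \<le> F (z (k + 3))"
      unfolding d_def by (rule descent_lemma_lower[OF grad lip])
    moreover have "L / 2 * (norm d)\<^sup>2 \<le> L / 2 * (2 * R)\<^sup>2"
      using d L_pos by (intro mult_left_mono power_mono) auto
    moreover have "- (norm p * (2 * R)) \<le> p \<bullet> d"
      using Cauchy_Schwarz_ineq2[of p d] mult_left_mono[OF d norm_ge_zero[of p]] by linarith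
    moreover have "p \<bullet> d = \<xi> 0 \<bullet> d + f (z 3) \<bullet> d" by (simp add: p_def inner_add_left)
    ultimately show ?thesis using E_le_value[of k] unfolding B_def by linarith
  qed
  then show ?thesis by blast
qed

definition "\<zeta> = lim value"

lemma value_lim: "value \<longlonglongrightarrow> \<zeta>" and \<zeta>_le: "\<zeta> \<le> value k"
proof -
  obtain B where "\<And>k. B \<le> value k" using value_bounded_below by blast
  then obtain l where "value \<longlonglongrightarrow> l" "\<And>i. l \<le> value i"
    using decseq_convergent[OF decseq_value] by metis
  then show "value \<longlonglongrightarrow> \<zeta>" "\<zeta> \<le> value k" unfolding \<zeta>_def by (auto simp: limI)
qed

lemma D_lim: "D \<longlonglongrightarrow> 0"
proof -
  have "(\<lambda>k. (D (k + 3))\<^sup>2) \<longlonglongrightarrow> 0"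
  proof (rule real_tendsto_sandwich[of "\<lambda>_. 0" _ _ "\<lambda>k. (value k - \<zeta>) / decay"])
    have "(D (k + 3))\<^sup>2 \<le> (value k - \<zeta>) / decay" for k
      using value_decrease[of k] \<zeta>_le[of "k + 1"] decay_pos
      by (subst pos_le_divide_eq) (auto simp: mult.commute)
    then show "\<forall>\<^sub>F k in sequentially. (D (k + 3))\<^sup>2 \<le> (value k - \<zeta>) / decay" by simp
    have "(\<lambda>k. (value k - \<zeta>) / decay) \<longlonglongrightarrow> (\<zeta> - \<zeta>) / decay"
      using decay_pos by (intro tendsto_divide tendsto_diff value_lim tendsto_const) simp
    then show "(\<lambda>k. (value k - \<zeta>) / decay) \<longlonglongrightarrow> 0" by simp
  qed auto
  then have "(\<lambda>k. sqrt ((D (k + 3))\<^sup>2)) \<longlonglongrightarrow> sqrt 0" by (rule tendsto_real_sqrt)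
  then have "(\<lambda>k. D (k + 3)) \<longlonglongrightarrow> 0" by simp
  then show ?thesis by (rule LIMSEQ_offset[of D 3])
qed

abbreviation "S k \<equiv> D (k + 2) + D (k + 1) + D k"

lemma S_lim: "(\<lambda>k. c * S k) \<longlonglongrightarrow> 0"
proof -
  have "(\<lambda>k. c * S k) \<longlonglongrightarrow> c * (0 + 0 + 0)"
    by (intro tendsto_mult tendsto_add tendsto_const D_lim D_lim[THEN LIMSEQ_ignore_initial_segment])
  then show ?thesis by simp
qed

lemma gap_element:
  obtains p where "p \<in> frechet_subdiff A (T k)" "norm p \<le> gap_const * S k"
  using relative_error[OF step \<beta>, of k] unfolding T_def D_shift D_def[symmetric] by blast

lemma residual_z: "norm (\<xi> k + f (z (k + 3))) \<le> residual_const * S k"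
  using residual_bound[OF \<beta>, of k "z (k + 2)" "z (k + 1)" "z k" "z (k + 3)"]
  unfolding \<xi>_def D_shift D_def[symmetric] .

lemma dist0_le_S: "dist0 (subdiff A (T k)) \<le> ereal (gap_const * S k)"
proof -
  obtain p where "p \<in> frechet_subdiff A (T k)" "norm p \<le> gap_const * S k" by (rule gap_element)
  then show ?thesis
    using dist0_le[of p "subdiff A (T k)"] frechet_subset_subdiff by (meson ereal_less_eq(3) order_trans subsetD)
qed

lemma dist0_lim: "(\<lambda>k. dist0 (subdiff A (T k))) \<longlonglongrightarrow> 0"
proof (rule tendsto_sandwich[of "\<lambda>_. 0" _ _ "\<lambda>k. ereal (gap_const * S k)"])
  have "(\<lambda>k. ereal (gap_const * S k)) \<longlonglongrightarrow> ereal 0" using S_lim[of gap_const] by (simp only: lim_ereal)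
  then show "(\<lambda>k. ereal (gap_const * S k)) \<longlonglongrightarrow> 0" by (simp only: zero_ereal_def)
qed (intro always_eventually allI dist0_nonneg dist0_le_S tendsto_const)+

text \<open>
Along the subsequence the values of \<open>H\<close> converge because those of \<open>A\<close> and of every
other term do, and the subgradients converge to \<open>- f zb\<close>; thus \<open>subgradient_limit_value\<close>
identifies the limit as \<open>H zb\<close>.  This is the attentive convergence which the limiting
subdifferential asks for, and the vanishing subgradients are its witnesses.
\<close>
lemma cluster_point_critical:
  assumes r: "strict_mono r" and lim: "(\<lambda>k. z (r k + 3)) \<longlonglongrightarrow> zb"
  shows "A (zb, zb, zb) = ereal \<zeta>" "critical_point A (zb, zb, zb)" "critical_point E zb"
proof -
  have sub_lim: "(\<lambda>k. X (r k)) \<longlonglongrightarrow> l" if "X \<longlonglongrightarrow> l" for X :: "nat \<Rightarrow> 'b::topological_space" and l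
    using LIMSEQ_subseq_LIMSEQ[OF that r] by (simp add: o_def)
  have diff_lim: "(\<lambda>k. z (k + 1) - z k) \<longlonglongrightarrow> 0"
    using D_lim by (simp add: D_def[abs_def] tendsto_norm_zero_iff)
  have "(\<lambda>k. z (k + 2 + 1) - z (k + 2)) \<longlonglongrightarrow> 0" "(\<lambda>k. z (k + 1 + 1) - z (k + 1)) \<longlonglongrightarrow> 0"
    using diff_lim[THEN LIMSEQ_ignore_initial_segment, of 2] diff_lim[THEN LIMSEQ_ignore_initial_segment, of 1]
    by simp_all
  then have diffs: "(\<lambda>k. z (k + 3) - z (k + 2)) \<longlonglongrightarrow> 0" "(\<lambda>k. z (k + 2) - z (k + 1)) \<longlonglongrightarrow> 0"
    by (simp_all add: numeral_eq_Suc)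
  have lim2: "(\<lambda>k. z (r k + 2)) \<longlonglongrightarrow> zb"
    using tendsto_diff[OF lim sub_lim[OF diffs(1)]] by simp
  have lim1: "(\<lambda>k. z (r k + 1)) \<longlonglongrightarrow> zb"
    using tendsto_diff[OF lim2 sub_lim[OF diffs(2)]] by simp
  have lim_T: "(\<lambda>k. T (r k)) \<longlonglongrightarrow> (zb, zb, zb)"
    unfolding T_def by (intro tendsto_Pair lim lim1 lim2)
  have val_lim: "(\<lambda>k. value (r k)) \<longlonglongrightarrow> \<zeta>" by (rule sub_lim[OF value_lim])
  have F_lim: "(\<lambda>k. F (z (r k + 3))) \<longlonglongrightarrow> F zb" by (rule isCont_tendsto_compose[OF isCont_F lim])
  have f_lim: "(\<lambda>k. f (z (r k + 3))) \<longlonglongrightarrow> f zb" by (rule isCont_tendsto_compose[OF isCont_f lim])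
  have M0: "M 0 = 0" using linear_M by (rule linear_0)
  have "(\<lambda>k. sq_seminorm M (z (r k + 3) - z (r k + 2))) \<longlonglongrightarrow> M 0 \<bullet> 0"
    unfolding sq_seminorm_def
    by (intro tendsto_inner isCont_tendsto_compose[OF isCont_M] sub_lim[OF diffs(1)])
  then have M_lim: "(\<lambda>k. sq_seminorm M (z (r k + 3) - z (r k + 2))) \<longlonglongrightarrow> 0" by simp
  have D2: "(\<lambda>k. D (r k + 2)) \<longlonglongrightarrow> 0" and D1: "(\<lambda>k. D (r k + 1)) \<longlonglongrightarrow> 0"
    using sub_lim[OF D_lim[THEN LIMSEQ_ignore_initial_segment]] by blast+
  have "(\<lambda>k. value (r k) - F (z (r k + 3))
      - (a * (D (r k + 2))\<^sup>2 + b * (D (r k + 1))\<^sup>2 + 1 / 2 * sq_seminorm M (z (r k + 3) - z (r k + 2))))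
      \<longlonglongrightarrow> \<zeta> - F zb - (a * 0\<^sup>2 + b * 0\<^sup>2 + 1 / 2 * 0)"
    by (intro tendsto_diff tendsto_add tendsto_mult tendsto_const tendsto_power val_lim F_lim M_lim D1 D2)
  then have h_lim: "(\<lambda>k. h (r k)) \<longlonglongrightarrow> \<zeta> - F zb" by (simp add: value_def)
  have "(\<lambda>k. \<xi> k + f (z (k + 3))) \<longlonglongrightarrow> 0"
    by (rule Lim_null_comparison[OF always_eventually[OF allI[OF residual_z]] S_lim])
  then have res_lim: "(\<lambda>k. \<xi> (r k) + f (z (r k + 3))) \<longlonglongrightarrow> 0" by (rule sub_lim)
  from tendsto_diff[OF this f_lim] have \<xi>_lim: "(\<lambda>k. \<xi> (r k)) \<longlonglongrightarrow> - f zb" by simp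
  have H_zb: "H zb = ereal (\<zeta> - F zb)"
    by (rule subgradient_limit_value[OF closed H_not_MInf subgradient_\<xi> H_z lim \<xi>_lim h_lim])
  show A_zb: "A (zb, zb, zb) = ereal \<zeta>"
    by (simp add: aux_energy_def energy_def H_zb sq_seminorm_def M0)
  have E_zb: "E zb = ereal \<zeta>" by (simp add: energy_def H_zb)
  show "critical_point E zb"
    unfolding critical_point_def subdiff_def mem_Collect_eq
  proof (intro conjI exI allI)
    show "(\<lambda>k. E (z (r k + 3))) \<longlonglongrightarrow> E zb"
      unfolding E_z E_zb lim_ereal using tendsto_add[OF h_lim F_lim] by simp
    show "\<xi> (r k) + f (z (r k + 3)) \<in> frechet_subdiff E (z (r k + 3))" for k
      by (rule frechet_subdiff_E[OF subgradient_\<xi>])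
  qed (use E_zb lim res_lim in auto)
  have "\<forall>k. \<exists>p. p \<in> frechet_subdiff A (T k) \<and> norm p \<le> gap_const * S k"
    by (blast intro: gap_element)
  then obtain p where "\<forall>k. p k \<in> frechet_subdiff A (T k) \<and> norm (p k) \<le> gap_const * S k"
    by (rule choice[THEN exE])
  then have p: "\<And>k. p k \<in> frechet_subdiff A (T k)" "\<And>k. norm (p k) \<le> gap_const * S k" by blast+
  have p_lim: "p \<longlonglongrightarrow> 0"
    by (rule Lim_null_comparison[OF always_eventually[OF allI[OF p(2)]] S_lim])
  show "critical_point A (zb, zb, zb)"
    unfolding critical_point_def subdiff_def mem_Collect_eq
  proof (intro conjI exI allI)
    show "(\<lambda>k. A (T (r k))) \<longlonglongrightarrow> A (zb, zb, zb)"
      unfolding A_T A_zb lim_ereal by (rule val_lim)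
    show "p (r k) \<in> frechet_subdiff A (T (r k))" for k by (rule p)
    show "(\<lambda>k. p (r k)) \<longlonglongrightarrow> 0" by (rule sub_lim[OF p_lim])
  qed (use A_zb lim_T in auto)
qed

lemma cluster_point_exists: obtains r zb where "strict_mono r" "(\<lambda>k. z (r k + 3)) \<longlonglongrightarrow> zb"
proof -
  have "bounded (range (\<lambda>k. z (k + 3)))" by (rule bounded_subset[OF bounded_z]) auto
  from bounded_imp_convergent_subsequence[OF this] that show ?thesis by (auto simp: o_def)
qed

text \<open>
If the value \<open>\<zeta>\<close> is attained, the descent inequality makes the sequence stationary from then
on.  Otherwise all values lie strictly above \<open>\<zeta>\<close>, as the KL inequality requires.
\<close>
lemma finite_length:
  assumes KL: "KL_property A"
  shows "summable D"
proof (cases "\<exists>k. value k = \<zeta>")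
  case True
  then obtain k where k: "value k = \<zeta>" by blast
  have "D i = 0" if "i \<notin> {..<k + 3}" for i
  proof -
    define j where "j = i - 3"
    have i: "i = j + 3" "k \<le> j" using that by (auto simp: j_def)
    have "value j \<le> \<zeta>" using decseqD[OF decseq_value i(2)] k by simp
    then have "decay * (D i)\<^sup>2 \<le> 0" using value_decrease[of j] \<zeta>_le[of "j + 1"] i by simp
    then show ?thesis using decay_pos by (simp add: mult_le_0_iff)
  qed
  then show ?thesis by (intro summable_finite[of "{..<k + 3}"]) auto
next
  case False
  then have above: "\<zeta> < value k" for k using \<zeta>_le[of k] by (metis order_le_less)
  obtain r zb where r: "strict_mono r" and lim: "(\<lambda>k. z (r k + 3)) \<longlonglongrightarrow> zb"
    by (rule cluster_point_exists)
  note A_zb = cluster_point_critical(1)[OF r lim]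
  obtain \<nu> U \<psi> \<psi>' where \<nu>: "(0::ereal) < \<nu>" and U: "open U" "(zb, zb, zb) \<in> U"
    and cont: "continuous_on {t. 0 \<le> t \<and> ereal t < \<nu>} \<psi>"
    and conc: "concave_on {t. 0 \<le> t \<and> ereal t < \<nu>} \<psi>"
    and nonneg: "\<forall>t. 0 \<le> t \<and> ereal t < \<nu> \<longrightarrow> 0 \<le> \<psi> t" and \<psi>0: "\<psi> 0 = 0"
    and der: "\<forall>t. 0 < t \<and> ereal t < \<nu> \<longrightarrow> (\<psi> has_real_derivative \<psi>' t) (at t) \<and> \<psi>' t > 0"
    and ineq: "\<forall>p\<in>U. A (zb, zb, zb) < A p \<and> A p < A (zb, zb, zb) + \<nu> \<longrightarrow>
       1 \<le> ereal (\<psi>' (real_of_ereal (A p - A (zb, zb, zb)))) * dist0 (subdiff A p)"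
    using KL[unfolded KL_property_def, THEN spec, THEN mp, OF cluster_point_critical(2)[OF r lim]]
    by (elim exE conjE) (rule that; assumption)
  obtain \<epsilon> where \<epsilon>: "0 < \<epsilon>" "ball (zb, zb, zb) \<epsilon> \<subseteq> U" using U open_contains_ball by blast
  define e where "e k = value k - \<zeta>" for k
  show ?thesis
    unfolding D_def[abs_def]
  proof (rule KL_finite_length[where e = e and c = decay and C = "max 0 gap_const" and \<rho> = "\<epsilon> / 3"
        and xb = zb and \<psi> = \<psi> and \<psi>' = \<psi>' and \<nu> = \<nu>], goal_cases)
    case (5 k)
    then show ?case using value_decrease[of k] by (simp add: e_def D_def)
  next
    case (6 k)
    then show ?case using above[of k] by (simp add: e_def)
  next
    case 7
    have "(\<lambda>k. value k - \<zeta>) \<longlonglongrightarrow> \<zeta> - \<zeta>" by (intro tendsto_diff value_lim tendsto_const)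
    then show ?case by (simp add: e_def[abs_def])
  next
    case (13 k)
    have "0 < e k" using above[of k] by (simp add: e_def)
    then have slope_pos: "0 < \<psi>' (e k)" using der 13(4) by blast
    have "dist (T k) (zb, zb, zb) \<le> dist (z (k + 3)) zb + (dist (z (k + 2)) zb + dist (z (k + 1)) zb)"
      using norm_Pair_le[of "z (k + 3) - zb" "(z (k + 2) - zb, z (k + 1) - zb)"]
        norm_Pair_le[of "z (k + 2) - zb" "z (k + 1) - zb"]
      by (simp add: T_def dist_norm)
    then have "T k \<in> U" using 13 \<epsilon>(2) by (auto simp: dist_commute)
    moreover have "A (zb, zb, zb) < A (T k)" using above[of k] by (simp add: A_zb A_T)
    moreover have "A (T k) < A (zb, zb, zb) + \<nu>"
      using 13(4) by (cases \<nu>) (auto simp: A_zb A_T e_def)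
    ultimately have "1 \<le> ereal (\<psi>' (real_of_ereal (A (T k) - A (zb, zb, zb)))) * dist0 (subdiff A (T k))"
      using ineq by blast
    then have "1 \<le> ereal (\<psi>' (e k)) * dist0 (subdiff A (T k))" by (simp add: A_zb A_T e_def)
    also have "\<dots> \<le> ereal (\<psi>' (e k)) * ereal (gap_const * S k)"
      using slope_pos by (intro ereal_mult_left_mono dist0_le_S) simp
    finally have "1 \<le> \<psi>' (e k) * (gap_const * S k)" by (simp add: one_ereal_def)
    also have "\<dots> \<le> \<psi>' (e k) * (max 0 gap_const * S k)"
      using slope_pos by (intro mult_left_mono mult_right_mono) auto
    finally show ?case by (simp add: D_def)
  next
    case (14 \<epsilon>' N)
    obtain K where K: "\<And>k. k \<ge> K \<Longrightarrow> dist (z (r k + 3)) zb < \<epsilon>'"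
      using lim 14 unfolding LIMSEQ_def by blast
    have "N \<le> r (max K N) + 3" using seq_suble[OF r, of "max K N"] by linarith
    then show ?case using K[of "max K N"] by (intro exI[of _ "r (max K N) + 3"]) auto
  qed (use decay_pos \<epsilon>(1) \<nu> cont conc nonneg \<psi>0 der in \<open>simp_all\<close>)
qed

lemma convergent_z:
  assumes "summable D"
  obtains zb where "z \<longlonglongrightarrow> zb" "critical_point E zb"
proof -
  have "summable (\<lambda>k. z (Suc k) - z k)"
    by (rule summable_norm_cancel) (use assms in \<open>simp add: D_def[abs_def]\<close>)
  then have "(\<lambda>n. \<Sum>k<n. z (Suc k) - z k) \<longlonglongrightarrow> (\<Sum>k. z (Suc k) - z k)" by (rule summable_LIMSEQ)
  then have diff_lim: "(\<lambda>n. z n - z 0) \<longlonglongrightarrow> (\<Sum>k. z (Suc k) - z k)"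
    unfolding sum_lessThan_telescope .
  define zb where "zb = (\<Sum>k. z (Suc k) - z k) + z 0"
  have lim: "z \<longlonglongrightarrow> zb"
    using tendsto_add[OF diff_lim tendsto_const[of "z 0"]] by (simp add: zb_def)
  then have "(\<lambda>k. z (id k + 3)) \<longlonglongrightarrow> zb"
    unfolding id_apply by (rule LIMSEQ_ignore_initial_segment)
  then have "critical_point E zb" by (rule cluster_point_critical(3)[OF strict_mono_id])
  with lim show ?thesis by (rule that)
qed

end

section \<open>Convergence of the iteration\<close>

theorem theorem1:
  fixes H :: "'a::euclidean_space \<Rightarrow> ereal"
    and F :: "'a \<Rightarrow> real"
    and f :: "'a \<Rightarrow> 'a"
    and M :: "'a \<Rightarrow> 'a"
    and L \<alpha> \<delta>t :: real
    and \<beta> :: "nat \<Rightarrow> real"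
    and x :: "int \<Rightarrow> 'a"
  assumes "proper_fun H" and "closed_fun H" and "convex_fun H"
    and "\<And>u. GDERIV F u :> f u"
    and "L > 0" and "L-lipschitz_on UNIV f"
    and "level_bounded (energy H F)"
    and "psd_operator M"
    and "\<alpha> > 4 / 77"
    and "0 < \<delta>t" and "\<delta>t < 8 / (77 * L)"
    and "\<And>n. n \<ge> 1 \<Longrightarrow> 0 \<le> \<beta> n \<and> \<beta> n < 1"
    and "(SUP n\<in>{1..}. \<beta> n) < 1"
    and "algorithm_sequence H F f M \<alpha> \<delta>t \<beta> x"
    and "KL_property (aux_energy H F L \<delta>t M)"
  shows "(\<lambda>n::nat. dist0 (subdiff (aux_energy H F L \<delta>t M)
             (x (int n + 1), x (int n), x (int n - 1)))) \<longlonglongrightarrow> 0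
     \<and>
         (decseq (\<lambda>n::nat. aux_energy H F L \<delta>t M (x (int n + 1), x (int n), x (int n - 1)))
         \<and> (\<exists>\<zeta>::real. (\<lambda>n::nat. aux_energy H F L \<delta>t M
              (x (int n + 1), x (int n), x (int n - 1))) \<longlonglongrightarrow> ereal \<zeta>)
         \<and> bounded (range (\<lambda>n::nat. x (int n))))
     \<and>
         ((\<exists>xb. (\<lambda>n::nat. x (int n)) \<longlonglongrightarrow> xb \<and> critical_point (energy H F) xb)
         \<and> summable (\<lambda>n::nat. norm (x (int n + 1) - x (int n))))"
proof -
  define z where "z k = x (int k - 1)" for k
  interpret scheme: bdf_scheme H F f M L \<alpha> \<delta>t
    by (rule bdf_scheme.intro) (rule assms)+
  interpret iter: bdf_iteration H F f M L \<alpha> \<delta>t "\<lambda>k. \<beta> (k + 1)" z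
  proof
    fix k
    show "0 \<le> \<beta> (k + 1)" "\<beta> (k + 1) \<le> 1" using assms(12)[of "k + 1"] by auto
    have "is_arg_min (step_objective H F f M \<alpha> \<delta>t (\<beta> (k + 1)) (x (int (k + 1)))
        (x (int (k + 1) - 1)) (x (int (k + 1) - 2))) (\<lambda>_. True) (x (int (k + 1) + 1))"
      using assms(14) unfolding algorithm_sequence_def by auto
    then show "scheme.is_step (\<beta> (k + 1)) (z (k + 2)) (z (k + 1)) (z k) (z (k + 3))"
      unfolding scheme.is_step_def z_def by (simp add: algebra_simps)
  qed
  let ?A = "aux_energy H F L \<delta>t M"
  let ?X = "\<lambda>n::nat. (x (int n + 1), x (int n), x (int n - 1))"
  have X: "?X n = (z (n + 2), z (n + 1), z n)" for n by (simp add: z_def algebra_simps)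
  have T: "iter.T n = ?X (n + 1)" for n by (simp add: iter.T_def z_def algebra_simps)
  have x_z: "x (int n) = z (n + 1)" for n by (simp add: z_def)
  \<comment> \<open>The triple with index 0 consists of starting points, where A may be infinite; the limits are taken from index 1 on.\<close>
  have "(\<lambda>n. dist0 (subdiff ?A (?X n))) \<longlonglongrightarrow> 0"
    by (rule LIMSEQ_offset[of _ 1]) (use iter.dist0_lim in \<open>simp only: T\<close>)
  moreover have "decseq (\<lambda>n. ?A (?X n))"
  proof (rule decseq_SucI)
    show "?A (?X (Suc n)) \<le> ?A (?X n)" for n
      using iter.A_antimono[of n] T[of n] X[of n] by simp
  qed
  moreover have "(\<lambda>n. ?A (?X n)) \<longlonglongrightarrow> ereal iter.\<zeta>"
  proof (rule LIMSEQ_offset[of "\<lambda>n. ?A (?X n)" 1])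
    show "(\<lambda>n. ?A (?X (n + 1))) \<longlonglongrightarrow> ereal iter.\<zeta>"
      unfolding T[symmetric] iter.A_T lim_ereal by (rule iter.value_lim)
  qed
  moreover have "bounded (range (\<lambda>n::nat. x (int n)))"
    by (rule bounded_subset[OF iter.bounded_z]) (auto simp: x_z)
  moreover have sum: "summable iter.D" by (rule iter.finite_length) (rule assms)
  moreover have "summable (\<lambda>n::nat. norm (x (int n + 1) - x (int n)))"
  proof -
    have "summable (\<lambda>n. iter.D (n + 1))" using sum by (rule summable_ignore_initial_segment)
    then show ?thesis by (simp add: iter.D_def z_def algebra_simps)
  qed
  moreover have "\<exists>xb. (\<lambda>n::nat. x (int n)) \<longlonglongrightarrow> xb \<and> critical_point (energy H F) xb"
  proof -
    obtain zb where "z \<longlonglongrightarrow> zb" "critical_point (energy H F) zb"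
      using iter.convergent_z[OF sum] by blast
    then show ?thesis unfolding x_z using LIMSEQ_ignore_initial_segment[of z zb 1] by auto
  qed
  ultimately show ?thesis by blast
qed

end
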